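(* Let $c\ge 0$ and $p\ge 2$. Let $Y=(Y_1,\dots,Y_p)$ have independent components $Y_i\sim\mathrm{Poisson}(\theta_i)$ with $\theta\in(0,\infty)^p$ unknown, and let $Z=\sum_{i=1}^pY_i$. The estimator $\delta^c=(\delta^c_1,\dots,\delta^c_p)$ given by $$\delta_i^c(Y)=\Bigl\{1-\frac{p-1}{p-1+(1+c)Z}\Bigr\}Y_i,\qquad i=1,\dots,p,$$ is admissible for $\theta$ under the loss function $$L_c(\theta,\delta)=\sum_{i=1}^p\frac{(\delta_i-\theta_i)^2}{\theta_i}+c\,\frac{\bigl(\sum_{i=1}^p\delta_i-\sum_{i=1}^p\theta_i\bigr)^2}{\sum_{i=1}^p\theta_i}.$$ In particular (the case $c=0$), the Clevenson--Zidek estimator $\bigl(1-\frac{p-1}{p-1+Z}\bigr)Y$ is admissible under the loss function $\sum_{i=1}^p(\delta_i-\theta_i)^2/\theta_i$.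
   Context: The risk of an estimator is $R_c(\delta,\theta)=\mathrm{E}_\theta L_c(\theta,\delta(Y))$. An estimator is admissible if no other estimator has risk that is less than or equal to its risk for every $\theta\in(0,\infty)^p$ and strictly smaller for at least one $\theta$. *)

theory Defs
  imports "HOL-Probability.Probability"
begin

text \<open>
  The dimension p is the cardinality of the finite index type; parameters and estimates are
  real vectors written as functions on it. The data is discrete, so every function of the data is
  measurable; estimators take arbitrary real values (componentwise).
\<close>

type_synonym 'n estimator = "('n \<Rightarrow> nat) \<Rightarrow> 'n \<Rightarrow> real"

definition poisson_vec :: "('n::finite \<Rightarrow> real) \<Rightarrow> ('n \<Rightarrow> nat) pmf" where
  "poisson_vec \<theta> = Pi_pmf UNIV 0 (\<lambda>i. poisson_pmf (\<theta> i))"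

definition param_space :: "('n::finite \<Rightarrow> real) set" where
  "param_space = {\<theta>. \<forall>i. 0 < \<theta> i}"

text \<open>
  The risk is an extended nonnegative expectation, so that an estimator with infinite risk does not
  get the junk value 0 of a non-integrable Bochner integral. It is meant for losses that are
  nonnegative on the parameter space.
\<close>

definition risk ::
    "(('n::finite \<Rightarrow> real) \<Rightarrow> ('n \<Rightarrow> real) \<Rightarrow> real) \<Rightarrow> 'n estimator \<Rightarrow> ('n \<Rightarrow> real) \<Rightarrow> ennreal" where
  "risk L \<delta> \<theta> = (\<integral>\<^sup>+ y. ennreal (L \<theta> (\<delta> y)) \<partial>measure_pmf (poisson_vec \<theta>))"

definition admissible ::
    "(('n::finite \<Rightarrow> real) \<Rightarrow> ('n \<Rightarrow> real) \<Rightarrow> real) \<Rightarrow> 'n estimator \<Rightarrow> bool" where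
  "admissible L \<delta> \<longleftrightarrow>
     \<not> (\<exists>\<delta>'. (\<forall>\<theta>\<in>param_space. risk L \<delta>' \<theta> \<le> risk L \<delta> \<theta>) \<and>
             (\<exists>\<theta>\<in>param_space. risk L \<delta>' \<theta> < risk L \<delta> \<theta>))"

definition std_loss :: "('n::finite \<Rightarrow> real) \<Rightarrow> ('n \<Rightarrow> real) \<Rightarrow> real" where
  "std_loss \<theta> d = (\<Sum>i\<in>UNIV. (d i - \<theta> i)\<^sup>2 / \<theta> i)"

definition loss :: "real \<Rightarrow> ('n::finite \<Rightarrow> real) \<Rightarrow> ('n \<Rightarrow> real) \<Rightarrow> real" where
  "loss c \<theta> d =
     (\<Sum>i\<in>UNIV. (d i - \<theta> i)\<^sup>2 / \<theta> i)
     + c * (((\<Sum>i\<in>UNIV. d i) - (\<Sum>i\<in>UNIV. \<theta> i))\<^sup>2 / (\<Sum>i\<in>UNIV. \<theta> i))"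

definition total :: "('n::finite \<Rightarrow> nat) \<Rightarrow> nat" where
  "total y = (\<Sum>i\<in>UNIV. y i)"

definition delta_c :: "real \<Rightarrow> 'n::finite estimator" where
  "delta_c c y i =
     (1 - (real CARD('n) - 1) / (real CARD('n) - 1 + (1 + c) * real (total y))) * real (y i)"

definition clevenson_zidek :: "'n::finite estimator" where
  "clevenson_zidek y i =
     (1 - (real CARD('n) - 1) / (real CARD('n) - 1 + real (total y))) * real (y i)"

end

theory Submission
  imports Defs
begin

text \<open>
  The argument is Blyth's method with an explicit sequence of proper priors. Write p for the
  dimension, \<psi> for the sum of the \<theta>'s and Z for the total count. The estimator is the formal Bayes
  rule for the improper density \<psi> powr (1 - p), that is, flat in \<psi> and uniform on the simplex of
  proportions. Such a density is a mixture, over u > 0 with weight u ^ (p - 2), of products of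
  exponential densities exp (-u \<psi>); this turns all posterior computations into products of gamma
  integrals followed by one integral in u. The substitution x = 1 / (1 + u) moves the mixing
  variable into the bounded interval (0, 1), where the marginal weight of an observation y is the
  polynomial factor x ^ Z.

  The prior is made proper by multiplying the mixing weight by the square of
  \<xi>(x) = 1 + ln (1 - x) / n on [0, 1 - exp (-n)], which vanishes at the right end. One integration
  by parts (\<open>taper_moment_recursion\<close>) shows that the gradient of the posterior loss at the estimator is
  controlled by \<xi>' alone. Completing the square then gives, for each observation y, an upper bound
  for how much any rival estimate can gain, diminished by half the squared distance between the two
  estimates (\<open>posterior_loss_comparison\<close>). Summed over all observations the possible gains are at
  most a constant times the integral of (\<xi>')^2 x (1 - x), hence O(1/n) (\<open>count_sum_taper_moment\<close>).

  An estimator that dominates has an integrated risk which is no larger, and the integrated risk is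
  finite because the risk is bounded (\<open>risk_delta_c_bounded\<close>) and the prior is proper. So the squared
  distance at a single observation y, weighted with a posterior mass that stays bounded away from
  zero as n grows (\<open>taper_moment_lower_bound\<close>), is O(1/n), and the two estimators coincide. The
  Clevenson--Zidek estimator is the case c = 0.
\<close>


section \<open>Gamma integrals of the tilted likelihood\<close>
definition gamma_kernel :: "nat \<Rightarrow> real \<Rightarrow> real \<Rightarrow> real" where
  "gamma_kernel k s t = (if 0 < t then t ^ k / fact k * exp (- s * t) else 0)"

text \<open>
  For \<theta> with positive coordinates this is the Poisson likelihood of y times exp (- (s - 1) \<psi>), where
  \<psi> is the sum of \<theta>; elsewhere it vanishes, so that integrals over the parameter space become
  integrals over the whole product space. The case s = 1 is the likelihood itself.
\<close>
definition tilted_lik :: "('n::finite \<Rightarrow> nat) \<Rightarrow> real \<Rightarrow> ('n \<Rightarrow> real) \<Rightarrow> real" where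
  "tilted_lik y s \<theta> = (\<Prod>i\<in>UNIV. gamma_kernel (y i) s (\<theta> i))"

abbreviation param_lebesgue :: "('n::finite \<Rightarrow> real) measure" where
  "param_lebesgue \<equiv> Pi\<^sub>M UNIV (\<lambda>_. lborel)"

lemma gamma_kernel_nonneg: "0 \<le> gamma_kernel k s t"
  by (auto simp: gamma_kernel_def)

lemma tilted_lik_nonneg: "0 \<le> tilted_lik y s \<theta>"
  by (auto simp: tilted_lik_def intro!: prod_nonneg gamma_kernel_nonneg)

lemma gamma_kernel_measurable[measurable]: "gamma_kernel k s \<in> borel_measurable borel"
  unfolding gamma_kernel_def by measurable

lemma component_measurable[measurable]:
  "(\<lambda>\<theta>. \<theta> i) \<in> borel_measurable (param_lebesgue :: ('n::finite \<Rightarrow> real) measure)"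
proof -
  have "(\<lambda>\<theta>. \<theta> i) \<in> measurable (param_lebesgue :: ('n \<Rightarrow> real) measure) lborel"
    by (rule measurable_component_singleton) simp
  thus ?thesis by simp
qed

lemma tilted_lik_measurable[measurable]:
  "tilted_lik y s \<in> borel_measurable (param_lebesgue :: ('n::finite \<Rightarrow> real) measure)"
  unfolding tilted_lik_def by measurable

lemma param_space_measurable[measurable]:
  "param_space \<in> sets (param_lebesgue :: ('n::finite \<Rightarrow> real) measure)"
proof -
  have "Measurable.pred (param_lebesgue :: ('n \<Rightarrow> real) measure) (\<lambda>\<theta>. \<forall>i. 0 < \<theta> i)"
    by measurable
  thus ?thesis by (simp add: param_space_def pred_def space_PiM)
qed

lemma tilted_lik_outside: "\<theta> \<notin> param_space \<Longrightarrow> tilted_lik y s \<theta> = 0"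
  by (auto simp: tilted_lik_def param_space_def gamma_kernel_def not_less)

lemma tilted_lik_shift:
  "tilted_lik y s \<theta> * exp (- r * (\<Sum>i\<in>UNIV. \<theta> i)) = tilted_lik y (s + r) \<theta>"
proof -
  have "exp (- r * (\<Sum>i\<in>UNIV. \<theta> i)) = (\<Prod>i\<in>UNIV. exp (- r * \<theta> i))"
    by (simp add: exp_sum sum_distrib_left)
  moreover have "gamma_kernel (y i) s (\<theta> i) * exp (- r * \<theta> i) = gamma_kernel (y i) (s + r) (\<theta> i)" for i
    by (auto simp: gamma_kernel_def exp_add[symmetric] algebra_simps)
  ultimately show ?thesis
    by (simp add: tilted_lik_def prod.distrib[symmetric])
qed

lemma pmf_poisson_vec:
  assumes "\<theta> \<in> param_space"
  shows "pmf (poisson_vec \<theta>) y = tilted_lik y 1 \<theta>"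
  using assms unfolding poisson_vec_def tilted_lik_def param_space_def
  by (subst pmf_Pi') (auto simp: gamma_kernel_def less_imp_le)

lemma nn_integral_gamma_kernel:
  assumes "0 < s"
  shows "(\<integral>\<^sup>+t. ennreal (gamma_kernel k s t) \<partial>lborel) = ennreal (1 / s ^ Suc k)"
proof -
  have "(\<integral>\<^sup>+t. ennreal (erlang_density k s t) \<partial>lborel) = 1"
    using prob_space.emeasure_space_1[OF prob_space_erlang_density[OF assms, of k]]
    by (simp add: emeasure_density)
  moreover have "(\<integral>\<^sup>+t. ennreal (gamma_kernel k s t) \<partial>lborel) =
      (\<integral>\<^sup>+t. ennreal (1 / s ^ Suc k) * ennreal (erlang_density k s t) \<partial>lborel)"
  proof (rule nn_integral_cong_AE)
    \<comment> \<open>the kernel vanishes at 0, whereas the Erlang density of shape 1 does not\<close>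
    have "AE t in lborel. t \<noteq> (0::real)" by (rule AE_lborel_singleton)
    thus "AE t in lborel. ennreal (gamma_kernel k s t) = ennreal (1 / s ^ Suc k) * ennreal (erlang_density k s t)"
    proof eventually_elim
      case (elim t)
      thus ?case using assms
        by (auto simp: gamma_kernel_def erlang_density_def ennreal_mult'[symmetric] field_simps)
    qed
  qed
  ultimately show ?thesis by (simp add: nn_integral_cmult)
qed

lemma nn_integral_prod_lborel:
  fixes f :: "'n::finite \<Rightarrow> real \<Rightarrow> ennreal"
  assumes "\<And>i. f i \<in> borel_measurable borel"
  shows "(\<integral>\<^sup>+\<theta>. (\<Prod>i\<in>UNIV. f i (\<theta> i)) \<partial>param_lebesgue) = (\<Prod>i\<in>UNIV. \<integral>\<^sup>+t. f i t \<partial>lborel)"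
proof -
  interpret product_sigma_finite "\<lambda>_::'n. lborel :: real measure" ..
  show ?thesis by (rule product_nn_integral_prod) (use assms in auto)
qed

lemma nn_integral_tilted_lik:
  fixes y :: "'n::finite \<Rightarrow> nat"
  assumes "0 < s"
  shows "(\<integral>\<^sup>+\<theta>. ennreal (tilted_lik y s \<theta>) \<partial>param_lebesgue) = ennreal (1 / s ^ (total y + CARD('n)))"
proof -
  have "(\<integral>\<^sup>+\<theta>. ennreal (tilted_lik y s \<theta>) \<partial>param_lebesgue) =
      (\<integral>\<^sup>+\<theta>. (\<Prod>i\<in>UNIV. ennreal (gamma_kernel (y i) s (\<theta> i))) \<partial>param_lebesgue)"
    by (simp add: tilted_lik_def prod_ennreal gamma_kernel_nonneg)
  also have "\<dots> = (\<Prod>i\<in>UNIV. ennreal (1 / s ^ Suc (y i)))"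
    using assms by (subst nn_integral_prod_lborel) (auto simp: nn_integral_gamma_kernel)
  also have "\<dots> = ennreal (\<Prod>i\<in>UNIV. 1 / s ^ Suc (y i))"
    using assms by (subst prod_ennreal) auto
  also have "(\<Prod>i\<in>UNIV. 1 / s ^ Suc (y i)) = 1 / s ^ (total y + CARD('n))"
    by (simp add: prod_dividef prod.distrib power_sum[symmetric] total_def power_add mult.commute)
  finally show ?thesis .
qed

text \<open>
  Dividing by a coordinate lowers its exponent by one, which gives the likelihood of the observation
  with one count less.
\<close>
lemma nn_integral_tilted_lik_over_component:
  fixes y :: "'n::finite \<Rightarrow> nat"
  assumes "0 < s" "0 < y i"
  shows "(\<integral>\<^sup>+\<theta>. ennreal (tilted_lik y s \<theta> / \<theta> i) \<partial>param_lebesgue) =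
    ennreal (1 / (real (y i) * s ^ (total y + CARD('n) - 1)))"
proof -
  \<comment> \<open>the observation with one count of coordinate i removed\<close>
  define y' where "y' = y(i := y i - 1)"
  have tot: "total y = Suc (total y')"
  proof -
    have "total y = y i + sum y (UNIV - {i})" "total y' = y' i + sum y' (UNIV - {i})"
      unfolding total_def by (simp_all add: sum.remove[of UNIV i])
    moreover have "sum y' (UNIV - {i}) = sum y (UNIV - {i})"
      by (rule sum.cong) (auto simp: y'_def)
    ultimately show ?thesis using assms by (simp add: y'_def)
  qed
  have "tilted_lik y s \<theta> / \<theta> i = tilted_lik y' s \<theta> / real (y i)" for \<theta> :: "'n \<Rightarrow> real"
  proof -
    have "tilted_lik y s \<theta> = gamma_kernel (y i) s (\<theta> i) * (\<Prod>j\<in>UNIV-{i}. gamma_kernel (y j) s (\<theta> j))"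
      "tilted_lik y' s \<theta> = gamma_kernel (y' i) s (\<theta> i) * (\<Prod>j\<in>UNIV-{i}. gamma_kernel (y' j) s (\<theta> j))"
      unfolding tilted_lik_def by (simp_all add: prod.remove[of UNIV i])
    moreover have "(\<Prod>j\<in>UNIV-{i}. gamma_kernel (y' j) s (\<theta> j)) = (\<Prod>j\<in>UNIV-{i}. gamma_kernel (y j) s (\<theta> j))"
      by (rule prod.cong) (auto simp: y'_def)
    moreover have "gamma_kernel (y i) s (\<theta> i) / \<theta> i = gamma_kernel (y' i) s (\<theta> i) / real (y i)"
      using assms by (cases "y i") (auto simp: gamma_kernel_def y'_def)
    ultimately show ?thesis by (metis times_divide_eq_left)
  qed
  hence "(\<integral>\<^sup>+\<theta>. ennreal (tilted_lik y s \<theta> / \<theta> i) \<partial>param_lebesgue) =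
      (\<integral>\<^sup>+\<theta>. ennreal (1 / real (y i)) * ennreal (tilted_lik y' s \<theta>) \<partial>param_lebesgue)"
    by (simp add: ennreal_mult'[symmetric] tilted_lik_nonneg)
  also have "\<dots> = ennreal (1 / real (y i)) * ennreal (1 / s ^ (total y' + CARD('n)))"
    using assms by (simp add: nn_integral_cmult nn_integral_tilted_lik)
  also have "\<dots> = ennreal (1 / (real (y i) * s ^ (total y + CARD('n) - 1)))"
    by (simp add: ennreal_mult'[symmetric] tot)
  finally show ?thesis .
qed

lemma nn_integral_exp_atLeast:
  fixes a s :: real
  assumes "0 < a"
  shows "(\<integral>\<^sup>+v. ennreal (exp (- v * a)) * indicator {s..} v \<partial>lborel) = ennreal (exp (- s * a) / a)"
proof -
  have "(\<integral>\<^sup>+v. ennreal (exp (- v * a)) * indicator {s..} v \<partial>lborel) =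
      ennreal (0 - (- exp (- s * a) / a))"
  proof (rule nn_integral_FTC_atLeast)
    show "((\<lambda>v. - exp (- v * a) / a) \<longlongrightarrow> 0) at_top"
    proof -
      have "filterlim (\<lambda>v::real. - a * v) at_bot at_top"
        using filterlim_tendsto_neg_mult_at_bot[of "\<lambda>_. - a" "- a" at_top "\<lambda>v. v"] assms
        by (simp add: filterlim_ident)
      from filterlim_compose[OF exp_at_bot this]
      have "((\<lambda>v. exp (- v * a)) \<longlongrightarrow> 0) at_top"
        by (simp add: mult.commute)
      hence "((\<lambda>v. - exp (- v * a) / a) \<longlongrightarrow> - 0 / a) at_top"
        by (intro tendsto_intros) (use assms in auto)
      thus ?thesis by simp
    qed
  qed (use assms in \<open>auto intro!: derivative_eq_intros\<close>)
  thus ?thesis by simp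
qed

lemma nn_integral_power_atLeast:
  fixes s :: real
  assumes "0 < s" "0 < m"
  shows "(\<integral>\<^sup>+v. ennreal (1 / v ^ Suc m) * indicator {s..} v \<partial>lborel) =
    ennreal (1 / (real m * s ^ m))"
proof -
  have "(\<integral>\<^sup>+v. ennreal (1 / v ^ Suc m) * indicator {s..} v \<partial>lborel) =
      ennreal (0 - (- (1 / (real m * s ^ m))))"
  proof (rule nn_integral_FTC_atLeast)
    show "((\<lambda>v. - (1 / (real m * v ^ m))) \<longlongrightarrow> 0) at_top"
    proof -
      have lim: "filterlim (\<lambda>v::real. v ^ m) at_top at_top"
        using assms by (intro filterlim_pow_at_top filterlim_ident)
      have "filterlim (\<lambda>v::real. real m * v ^ m) at_top at_top"
        using assms by (intro filterlim_tendsto_pos_mult_at_top[OF tendsto_const _ lim]) simp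
      hence "((\<lambda>v. inverse (real m * v ^ m)) \<longlongrightarrow> 0) at_top"
        by (rule tendsto_inverse_0_at_top)
      hence "((\<lambda>v. - inverse (real m * v ^ m)) \<longlongrightarrow> - 0) at_top"
        by (rule tendsto_minus)
      thus ?thesis by (simp add: divide_inverse)
    qed
    fix v :: real assume "s \<le> v"
    hence v: "0 < v" using assms by simp
    obtain k where k: "m = Suc k" using assms by (cases m) auto
    have "DERIV (\<lambda>v. inverse (v ^ m)) v :> - (real m * v ^ (m - Suc 0) * inverse ((v ^ m)\<^sup>2))"
      using DERIV_inverse_fun[OF DERIV_pow[of m v]] v by (simp add: numeral_2_eq_2)
    hence "DERIV (\<lambda>v. - (1 / real m) * inverse (v ^ m)) v :>
        - (1 / real m) * - (real m * v ^ (m - Suc 0) * inverse ((v ^ m)\<^sup>2))"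
      by (rule DERIV_cmult)
    moreover have "- (1 / real m) * - (real m * v ^ (m - Suc 0) * inverse ((v ^ m)\<^sup>2)) = 1 / v ^ Suc m"
    proof -
      have "- (1 / real m) * - (real m * v ^ (m - Suc 0) * inverse ((v ^ m)\<^sup>2)) =
          v ^ (m - Suc 0) * inverse ((v ^ m)\<^sup>2)"
        using assms by simp
      also have "\<dots> = 1 / v ^ Suc m"
        using v unfolding k by (simp add: field_simps power2_eq_square)
      finally show ?thesis .
    qed
    moreover have "(\<lambda>v. - (1 / real m) * inverse (v ^ m)) = (\<lambda>v. - (1 / (real m * v ^ m)))"
      by (simp add: field_simps)
    ultimately show "DERIV (\<lambda>v. - (1 / (real m * v ^ m))) v :> 1 / v ^ Suc m"
      by simp
  qed (use assms in auto)
  thus ?thesis by simp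
qed

text \<open>
  Since exp (- s \<psi>) / \<psi> is the integral of exp (- v \<psi>) over v \<ge> s, dividing by \<psi> amounts to
  integrating the product formula in the tilt.
\<close>
lemma nn_integral_tilted_lik_over_sum:
  fixes y :: "'n::finite \<Rightarrow> nat"
  assumes "0 < s" "2 \<le> CARD('n)"
  shows "(\<integral>\<^sup>+\<theta>. ennreal (tilted_lik y s \<theta> / (\<Sum>i\<in>UNIV. \<theta> i)) \<partial>param_lebesgue) =
    ennreal (1 / (real (total y + CARD('n) - 1) * s ^ (total y + CARD('n) - 1)))"
proof -
  let ?L = "param_lebesgue :: ('n \<Rightarrow> real) measure"
  define N where "N = total y + CARD('n) - 1"
  have N: "total y + CARD('n) = Suc N" "0 < N" using assms by (auto simp: N_def)
  interpret L: product_sigma_finite "\<lambda>_::'n. lborel :: real measure" ..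
  interpret L: sigma_finite_measure ?L by (rule L.sigma_finite) simp
  interpret pair_sigma_finite ?L lborel ..
  have "(\<integral>\<^sup>+\<theta>. ennreal (tilted_lik y s \<theta> / (\<Sum>i\<in>UNIV. \<theta> i)) \<partial>?L) =
     (\<integral>\<^sup>+\<theta>. (\<integral>\<^sup>+v. ennreal (tilted_lik y 0 \<theta> * exp (- v * (\<Sum>i\<in>UNIV. \<theta> i))) * indicator {s..} v \<partial>lborel) \<partial>?L)"
  proof (rule nn_integral_cong)
    fix \<theta> :: "'n \<Rightarrow> real"
    show "ennreal (tilted_lik y s \<theta> / (\<Sum>i\<in>UNIV. \<theta> i)) =
     (\<integral>\<^sup>+v. ennreal (tilted_lik y 0 \<theta> * exp (- v * (\<Sum>i\<in>UNIV. \<theta> i))) * indicator {s..} v \<partial>lborel)"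
    proof (cases "\<theta> \<in> param_space")
      case True
      hence pos: "0 < (\<Sum>i\<in>UNIV. \<theta> i)" by (auto simp: param_space_def intro!: sum_pos)
      have "(\<integral>\<^sup>+v. ennreal (tilted_lik y 0 \<theta> * exp (- v * (\<Sum>i\<in>UNIV. \<theta> i))) * indicator {s..} v \<partial>lborel)
        = (\<integral>\<^sup>+v. ennreal (tilted_lik y 0 \<theta>) * (ennreal (exp (- v * (\<Sum>i\<in>UNIV. \<theta> i))) * indicator {s..} v) \<partial>lborel)"
        by (simp add: ennreal_mult' tilted_lik_nonneg mult.assoc)
      also have "\<dots> = ennreal (tilted_lik y 0 \<theta>) * ennreal (exp (- s * (\<Sum>i\<in>UNIV. \<theta> i)) / (\<Sum>i\<in>UNIV. \<theta> i))"
        by (simp add: nn_integral_cmult nn_integral_exp_atLeast[OF pos, simplified])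
      also have "\<dots> = ennreal (tilted_lik y s \<theta> / (\<Sum>i\<in>UNIV. \<theta> i))"
        using tilted_lik_shift[of y 0 \<theta> s] by (simp add: ennreal_mult'[symmetric] tilted_lik_nonneg)
      finally show ?thesis by simp
    qed (simp add: tilted_lik_outside)
  qed
  also have "\<dots> = (\<integral>\<^sup>+v. (\<integral>\<^sup>+\<theta>. ennreal (tilted_lik y 0 \<theta> * exp (- v * (\<Sum>i\<in>UNIV. \<theta> i))) * indicator {s..} v \<partial>?L) \<partial>lborel)"
    by (rule Fubini'[symmetric]) measurable
  also have "\<dots> = (\<integral>\<^sup>+v. ennreal (1 / v ^ Suc N) * indicator {s..} v \<partial>lborel)"
  proof (rule nn_integral_cong)
    fix v :: real
    show "(\<integral>\<^sup>+\<theta>. ennreal (tilted_lik y 0 \<theta> * exp (- v * (\<Sum>i\<in>UNIV. \<theta> i))) * indicator {s..} v \<partial>?L) =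
      ennreal (1 / v ^ Suc N) * indicator {s..} v"
      using assms nn_integral_tilted_lik[of v y] tilted_lik_shift[of y 0 _ v] N(1)
      by (cases "v \<ge> s") simp_all
  qed
  also have "\<dots> = ennreal (1 / (real N * s ^ N))"
    by (rule nn_integral_power_atLeast) (use assms N in auto)
  finally show ?thesis by (simp add: N_def)
qed


section \<open>One-dimensional integrals with a logarithmic taper\<close>
definition cutoff :: "nat \<Rightarrow> real" where
  "cutoff n = 1 - exp (- real n)"

text \<open>
  The taper is linear in ln (1 - x). Among functions that fall from 1 to 0 it (nearly) minimizes the
  integral of its squared derivative against x (1 - x), which is what decides whether the gains of
  rival estimators vanish in the limit.
\<close>
definition log_taper :: "nat \<Rightarrow> real \<Rightarrow> real" where
  "log_taper n x = 1 + ln (1 - x) / real n"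

text \<open>
  The exponent q stands for p - 2. Only j = 0, 1, 2 occur: the prior carries the square of the taper,
  an integration by parts removes one factor, and completing the square leaves none.
\<close>
definition taper_integrand :: "nat \<Rightarrow> nat \<Rightarrow> nat \<Rightarrow> nat \<Rightarrow> real \<Rightarrow> real" where
  "taper_integrand q n j m x = log_taper n x ^ j * (1 - x) ^ q * x ^ m"

definition taper_moment :: "nat \<Rightarrow> nat \<Rightarrow> nat \<Rightarrow> nat \<Rightarrow> real" where
  "taper_moment q n j m = (LBINT x:{0..cutoff n}. taper_integrand q n j m x)"

lemma cutoff_bounds: "0 \<le> cutoff n" "cutoff n < 1" "0 < n \<Longrightarrow> 0 < cutoff n"
  by (auto simp: cutoff_def)

lemma log_taper_nonneg:
  assumes "0 < n" "x \<le> cutoff n"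
  shows "0 \<le> log_taper n x"
proof -
  have "exp (- real n) \<le> 1 - x" using assms by (simp add: cutoff_def)
  hence "- real n \<le> ln (1 - x)" by (subst ln_ge_iff) (use exp_gt_zero[of "- real n"] in linarith)+
  hence "- real n / real n \<le> ln (1 - x) / real n" by (rule divide_right_mono) simp
  thus ?thesis using assms by (simp add: log_taper_def)
qed

lemma log_taper_at_cutoff: "0 < n \<Longrightarrow> log_taper n (cutoff n) = 0"
  by (simp add: log_taper_def cutoff_def)

lemma log_taper_measurable[measurable]: "log_taper n \<in> borel_measurable borel"
  unfolding log_taper_def by measurable

lemma taper_integrand_measurable[measurable]: "taper_integrand q n j m \<in> borel_measurable borel"
  unfolding taper_integrand_def by measurable

lemma continuous_on_log_taper: "continuous_on {0..cutoff n} (log_taper n)"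
  using cutoff_bounds[of n] unfolding log_taper_def by (cases "n = 0") (auto intro!: continuous_intros)

lemma continuous_on_mom_integrand: "continuous_on {0..cutoff n} (taper_integrand q n j m)"
  unfolding taper_integrand_def[abs_def]
  by (intro continuous_intros continuous_on_log_taper)

lemma taper_moment_integrable: "set_integrable lborel {0..cutoff n} (taper_integrand q n j m)"
  by (rule borel_integrable_atLeastAtMost'[OF continuous_on_mom_integrand])

lemma taper_integrand_nonneg:
  assumes "0 < n" "0 \<le> x" "x \<le> cutoff n"
  shows "0 \<le> taper_integrand q n j m x"
  using assms log_taper_nonneg[of n x] cutoff_bounds[of n] by (simp add: taper_integrand_def)

lemma taper_moment_nonneg: "0 < n \<Longrightarrow> 0 \<le> taper_moment q n j m"
  unfolding taper_moment_def set_lebesgue_integral_def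
  by (rule integral_nonneg_AE) (use taper_integrand_nonneg in \<open>auto intro!: AE_I2 split: split_indicator\<close>)

lemma nn_integral_taper_moment:
  assumes "0 < n"
  shows "(\<integral>\<^sup>+x. ennreal (taper_integrand q n j m x) * indicator {0..cutoff n} x \<partial>lborel) = ennreal (taper_moment q n j m)"
proof -
  have "(\<integral>\<^sup>+x. ennreal (taper_integrand q n j m x) * indicator {0..cutoff n} x \<partial>lborel) =
      (\<integral>\<^sup>+x. ennreal (indicator {0..cutoff n} x *\<^sub>R taper_integrand q n j m x) \<partial>lborel)"
    by (rule nn_integral_cong) (auto split: split_indicator)
  also have "\<dots> = ennreal (\<integral>x. indicator {0..cutoff n} x *\<^sub>R taper_integrand q n j m x \<partial>lborel)"
    by (rule nn_integral_eq_integral)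
      (use taper_moment_integrable[of n q j m] taper_integrand_nonneg[OF assms] in
        \<open>auto simp: set_integrable_def split: split_indicator\<close>)
  finally show ?thesis by (simp add: taper_moment_def set_lebesgue_integral_def)
qed

text \<open>
  This is the integral of the derivative of \<xi>^2 (1 - x) ^ (q + 1) x ^ (m + 1), where \<xi> is the taper;
  the boundary terms vanish because x ^ (m + 1) is zero at 0 and \<xi> is zero at the cutoff. Without the
  taper the right-hand side would be zero, which says that the estimator is formally Bayes; the
  right-hand side is the price of making the prior proper.
\<close>
lemma taper_moment_recursion:
  assumes "0 < n"
  shows "real (Suc m) * taper_moment q n 2 m - real (m + q + 2) * taper_moment q n 2 (Suc m) =
    2 / real n * taper_moment q n 1 (Suc m)"
proof -
  define F where "F x = log_taper n x ^ 2 * (1 - x) ^ Suc q * x ^ Suc m" for x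
  define f where "f x = real (Suc m) * taper_integrand q n 2 m x - real (m + q + 2) * taper_integrand q n 2 (Suc m) x
      - 2 / real n * taper_integrand q n 1 (Suc m) x" for x
  have "integral\<^sup>L lborel (\<lambda>x. indicator {0..cutoff n} x *\<^sub>R f x) = F (cutoff n) - F 0"
  proof (rule integral_FTC_atLeastAtMost)
    show "continuous_on {0..cutoff n} f"
      unfolding f_def by (intro continuous_intros continuous_on_mom_integrand)
    fix x assume x: "0 \<le> x" "x \<le> cutoff n"
    hence "x < 1" using cutoff_bounds[of n] by simp
    have "DERIV (log_taper n) x :> - 1 / (real n * (1 - x))"
      unfolding log_taper_def[abs_def] using assms \<open>x < 1\<close>
      by (auto intro!: derivative_eq_intros simp: field_simps)
    hence d1: "DERIV (\<lambda>x. (log_taper n x)\<^sup>2) x :> 2 * log_taper n x * (- 1 / (real n * (1 - x)))"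
      by (auto intro!: derivative_eq_intros)
    have d2: "DERIV (\<lambda>x. (1 - x) ^ Suc q) x :> - (real (Suc q) * (1 - x) ^ q)"
      by (auto intro!: derivative_eq_intros simp del: power_Suc)
    have d3: "DERIV (\<lambda>x. x ^ Suc m) x :> real (Suc m) * x ^ m"
      by (auto intro!: derivative_eq_intros simp del: power_Suc)
    have cancel: "2 * log_taper n x * (- 1 / (real n * (1 - x))) * (1 - x) ^ Suc q =
        - 2 / real n * log_taper n x * (1 - x) ^ q"
      using assms \<open>x < 1\<close> by (simp add: field_simps)
    have "DERIV F x :> (2 * log_taper n x * (- 1 / (real n * (1 - x))) * (1 - x) ^ Suc q
        + - (real (Suc q) * (1 - x) ^ q) * (log_taper n x)\<^sup>2) * x ^ Suc m
        + real (Suc m) * x ^ m * ((log_taper n x)\<^sup>2 * (1 - x) ^ Suc q)"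
      unfolding F_def by (rule DERIV_mult[OF DERIV_mult[OF d1 d2] d3])
    also have "(2 * log_taper n x * (- 1 / (real n * (1 - x))) * (1 - x) ^ Suc q
        + - (real (Suc q) * (1 - x) ^ q) * (log_taper n x)\<^sup>2) * x ^ Suc m
        + real (Suc m) * x ^ m * ((log_taper n x)\<^sup>2 * (1 - x) ^ Suc q) = f x"
      unfolding cancel by (simp add: f_def taper_integrand_def algebra_simps)
    finally have "(F has_real_derivative f x) (at x)" .
    thus "(F has_vector_derivative f x) (at x within {0..cutoff n})"
      unfolding has_real_derivative_iff_has_vector_derivative by (rule has_vector_derivative_at_within)
  qed (rule cutoff_bounds)
  also have "F (cutoff n) - F 0 = 0"
    using assms by (simp add: F_def log_taper_at_cutoff)
  also have "integral\<^sup>L lborel (\<lambda>x. indicator {0..cutoff n} x *\<^sub>R f x) = (LBINT x:{0..cutoff n}. f x)"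
    by (simp add: set_lebesgue_integral_def)
  also have "\<dots> = real (Suc m) * taper_moment q n 2 m - real (m + q + 2) * taper_moment q n 2 (Suc m)
      - 2 / real n * taper_moment q n 1 (Suc m)"
    unfolding f_def taper_moment_def
    by (subst set_integral_diff set_integral_mult_right,
      (intro set_integral_diff set_integrable_mult_right taper_moment_integrable)+)+ simp
  finally show ?thesis by simp
qed

text \<open>
  Here the integrand is (a \<xi> + b x)^2 (1 - x) ^ q x ^ m, with \<xi> the taper. The variable a will be the
  change in the sum of the estimates, and b will be chosen to cancel the linear term of the posterior
  loss.
\<close>
lemma taper_moment_square_nonneg:
  assumes "0 < n"
  shows "0 \<le> a\<^sup>2 * taper_moment q n 2 m + 2 * a * b * taper_moment q n 1 (Suc m) + b\<^sup>2 * taper_moment q n 0 (m + 2)"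
proof -
  have nonneg: "0 \<le> a\<^sup>2 * taper_integrand q n 2 m x + 2 * a * b * taper_integrand q n 1 (Suc m) x
      + b\<^sup>2 * taper_integrand q n 0 (m + 2) x" if x: "x \<in> {0..cutoff n}" for x
  proof -
    have "a\<^sup>2 * taper_integrand q n 2 m x + 2 * a * b * taper_integrand q n 1 (Suc m) x
      + b\<^sup>2 * taper_integrand q n 0 (m + 2) x = (a * log_taper n x + b * x)\<^sup>2 * (1 - x) ^ q * x ^ m"
      by (simp add: taper_integrand_def power2_eq_square algebra_simps)
    also have "\<dots> \<ge> 0" using x cutoff_bounds[of n] by simp
    finally show "0 \<le> a\<^sup>2 * taper_integrand q n 2 m x + 2 * a * b * taper_integrand q n 1 (Suc m) x
      + b\<^sup>2 * taper_integrand q n 0 (m + 2) x" .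
  qed
  have "0 \<le> (LBINT x:{0..cutoff n}. a\<^sup>2 * taper_integrand q n 2 m x + 2 * a * b * taper_integrand q n 1 (Suc m) x
      + b\<^sup>2 * taper_integrand q n 0 (m + 2) x)"
    unfolding set_lebesgue_integral_def
    by (rule integral_nonneg_AE) (use nonneg in \<open>auto intro!: AE_I2 split: split_indicator\<close>)
  also have "\<dots> = a\<^sup>2 * taper_moment q n 2 m + 2 * a * b * taper_moment q n 1 (Suc m) + b\<^sup>2 * taper_moment q n 0 (m + 2)"
    unfolding taper_moment_def
    by (simp add: set_integral_add set_integrable_mult_right taper_moment_integrable)
  finally show ?thesis .
qed

text \<open>
  On [0, 1/2] the taper is at least 1 - ln 2, whatever n is.
\<close>
lemma taper_moment_lower_bound:
  "\<exists>r>0. \<forall>n>0. r \<le> taper_moment q n 2 m"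
proof -
  define g where "g x = (1 - ln 2)\<^sup>2 * (1/2) ^ q * (x::real) ^ m" for x
  have l2: "ln 2 < (1::real)" by (rule ln_2_less_1)
  have gint: "set_integrable lborel {0..1/2} g" unfolding g_def
    by (intro borel_integrable_atLeastAtMost' continuous_intros)
  define r where "r = (LBINT x:{0..1/2}. g x)"
  have "r = (1 - ln 2)\<^sup>2 * (1/2) ^ q * (1/2) ^ Suc m / real (Suc m)"
  proof -
    have "(\<integral>x. indicator {0..1/2} x *\<^sub>R g x \<partial>lborel) =
       (1 - ln 2)\<^sup>2 * (1/2) ^ q * (1/2) ^ Suc m / real (Suc m) - (1 - ln 2)\<^sup>2 * (1/2) ^ q * 0 ^ Suc m / real (Suc m)"
    proof (rule integral_FTC_atLeastAtMost)
      fix x :: real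
      have "((\<lambda>x. (1 - ln 2)\<^sup>2 * (1/2) ^ q * x ^ Suc m / real (Suc m)) has_real_derivative g x) (at x)"
        unfolding g_def by (auto intro!: derivative_eq_intros simp del: power_Suc)
      thus "((\<lambda>x. (1 - ln 2)\<^sup>2 * (1/2) ^ q * x ^ Suc m / real (Suc m)) has_vector_derivative g x) (at x within {0..1/2})"
        unfolding has_real_derivative_iff_has_vector_derivative by (rule has_vector_derivative_at_within)
    qed (auto simp: g_def intro!: continuous_intros)
    thus ?thesis by (simp add: r_def set_lebesgue_integral_def)
  qed
  hence "0 < r" using l2 by simp
  moreover have "r \<le> taper_moment q n 2 m" if n: "0 < n" for n
  proof -
    have half: "1 / 2 \<le> cutoff n"
    proof -
      have "exp (- real n) \<le> exp (- ln 2)" using n l2 by simp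
      thus ?thesis by (simp add: cutoff_def exp_minus)
    qed
    have "r = (\<integral>x. indicator {0..1/2} x *\<^sub>R g x \<partial>lborel)" by (simp add: r_def set_lebesgue_integral_def)
    also have "\<dots> \<le> (\<integral>x. indicator {0..cutoff n} x *\<^sub>R taper_integrand q n 2 m x \<partial>lborel)"
    proof (rule integral_mono)
      fix x :: real
      show "indicator {0..1/2} x *\<^sub>R g x \<le> indicator {0..cutoff n} x *\<^sub>R taper_integrand q n 2 m x"
      proof (cases "x \<in> {0..1/2}")
        case True
        hence x: "0 \<le> x" "x \<le> 1/2" by auto
        have "- ln 2 \<le> ln (1 - x)" 
        proof -
          have "ln (1/2) \<le> ln (1 - x)" using x by (subst ln_le_cancel_iff) auto
          thus ?thesis by (simp add: ln_div)
        qed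
        hence "- ln 2 \<le> ln (1 - x) / real n"
        proof -
          have "ln (1 - x) \<le> 0" using x by simp
          hence "ln (1 - x) * real n \<le> ln (1 - x) * 1" using n by (intro mult_left_mono_neg) auto
          hence "ln (1 - x) \<le> ln (1 - x) / real n" using n by (simp add: field_simps)
          thus ?thesis using \<open>- ln 2 \<le> ln (1 - x)\<close> by linarith
        qed
        hence "1 - ln 2 \<le> log_taper n x" by (simp add: log_taper_def)
        hence "(1 - ln 2)\<^sup>2 \<le> (log_taper n x)\<^sup>2" using l2 by (intro power_mono) auto
        moreover have "(1/2) ^ q \<le> (1 - x) ^ q" using x by (intro power_mono) auto
        ultimately have "g x \<le> taper_integrand q n 2 m x"
          using x unfolding g_def taper_integrand_def by (intro mult_mono) auto
        thus ?thesis using x half by simp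
      next
        case False
        thus ?thesis using taper_integrand_nonneg[OF n, of x q 2 m] by (auto split: split_indicator)
      qed
    qed (use gint taper_moment_integrable[of n q 2 m] in \<open>simp_all add: set_integrable_def\<close>)
    finally show ?thesis by (simp add: taper_moment_def set_lebesgue_integral_def)
  qed
  ultimately show ?thesis by blast
qed


section \<open>The sequence of proper priors\<close>
text \<open>
  The weight u ^ (p - 2) du, transported to x = 1 / (1 + u) and multiplied by the squared taper. The
  tilt exp (- u \<psi>) becomes exp (- (1 / x - 1) \<psi>) in the prior.
\<close>
definition mixing_density :: "nat \<Rightarrow> nat \<Rightarrow> real \<Rightarrow> real" where
  "mixing_density p n x =
     (if 0 < x \<and> x \<le> cutoff n then (log_taper n x)\<^sup>2 * (1 - x) ^ (p - 2) / x ^ p else 0)"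

definition prior :: "nat \<Rightarrow> ('n::finite \<Rightarrow> real) measure" where
  "prior n = density param_lebesgue (\<lambda>\<theta>. indicator param_space \<theta> *
     (\<integral>\<^sup>+x. ennreal (mixing_density CARD('n) n x * exp (- (1 / x - 1) * (\<Sum>i\<in>UNIV. \<theta> i))) \<partial>lborel))"

lemma mixing_density_nonneg: "0 \<le> mixing_density p n x"
  using cutoff_bounds[of n] by (auto simp: mixing_density_def)

lemma mixing_density_measurable[measurable]: "mixing_density p n \<in> borel_measurable borel"
  unfolding mixing_density_def by measurable

lemma sigma_finite_param_lebesgue: "sigma_finite_measure (param_lebesgue :: ('n::finite \<Rightarrow> real) measure)"
proof -
  interpret product_sigma_finite "\<lambda>_::'n. lborel :: real measure" ..
  show ?thesis by (rule sigma_finite) simp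
qed

lemma sets_prior[measurable_cong]: "sets (prior n :: ('n::finite \<Rightarrow> real) measure) = sets param_lebesgue"
  by (simp add: prior_def)

lemma space_prior[simp]: "space (prior n :: ('n::finite \<Rightarrow> real) measure) = UNIV"
  by (simp add: prior_def space_PiM)

lemma nn_integral_prior:
  fixes h :: "('n::finite \<Rightarrow> real) \<Rightarrow> ennreal"
  assumes [measurable]: "h \<in> borel_measurable param_lebesgue"
  shows "(\<integral>\<^sup>+\<theta>. h \<theta> \<partial>prior n) = (\<integral>\<^sup>+x. ennreal (mixing_density CARD('n) n x) *
     (\<integral>\<^sup>+\<theta>. ennreal (exp (- (1 / x - 1) * (\<Sum>i\<in>UNIV. \<theta> i))) * (indicator param_space \<theta> * h \<theta>)
       \<partial>param_lebesgue) \<partial>lborel)"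
proof -
  let ?L = "param_lebesgue :: ('n \<Rightarrow> real) measure"
  define k where "k = mixing_density CARD('n) n"
  have [measurable]: "k \<in> borel_measurable borel" and k_nonneg: "0 \<le> k x" for x
    by (simp_all add: k_def mixing_density_nonneg)
  interpret L: sigma_finite_measure ?L by (rule sigma_finite_param_lebesgue)
  interpret pair_sigma_finite ?L lborel ..
  let ?e = "\<lambda>x \<theta>. exp (- (1 / x - 1) * (\<Sum>i\<in>UNIV. \<theta> i))"
  have "(\<integral>\<^sup>+\<theta>. h \<theta> \<partial>prior n) =
      (\<integral>\<^sup>+\<theta>. (\<integral>\<^sup>+x. ennreal (k x * ?e x \<theta>) * (indicator param_space \<theta> * h \<theta>) \<partial>lborel) \<partial>?L)"
    unfolding prior_def k_def[symmetric]
    by (subst nn_integral_density)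
      (measurable, auto intro!: nn_integral_cong simp: nn_integral_cmult nn_integral_multc mult_ac)
  also have "\<dots> = (\<integral>\<^sup>+x. (\<integral>\<^sup>+\<theta>. ennreal (k x * ?e x \<theta>) * (indicator param_space \<theta> * h \<theta>) \<partial>?L) \<partial>lborel)"
    by (rule Fubini'[symmetric]) measurable
  also have "\<dots> = (\<integral>\<^sup>+x. (\<integral>\<^sup>+\<theta>. ennreal (k x) * (ennreal (?e x \<theta>) * (indicator param_space \<theta> * h \<theta>)) \<partial>?L) \<partial>lborel)"
    by (simp add: ennreal_mult'[OF k_nonneg] mult.assoc)
  also have "\<dots> = (\<integral>\<^sup>+x. ennreal (k x) *
     (\<integral>\<^sup>+\<theta>. ennreal (?e x \<theta>) * (indicator param_space \<theta> * h \<theta>) \<partial>?L) \<partial>lborel)"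
    by (simp add: nn_integral_cmult)
  finally show ?thesis unfolding k_def .
qed

text \<open>
  Because the prior mixes exponential tilts, the likelihood integrated against it is a mixture over x
  of tilted likelihoods with s = 1 / x, to which the gamma integrals apply.
\<close>
lemma nn_integral_prior_tilted_lik:
  fixes h :: "('n::finite \<Rightarrow> real) \<Rightarrow> real"
  assumes [measurable]: "h \<in> borel_measurable param_lebesgue"
  shows "(\<integral>\<^sup>+\<theta>. ennreal (tilted_lik y 1 \<theta> * h \<theta>) \<partial>prior n) =
     (\<integral>\<^sup>+x. ennreal (mixing_density CARD('n) n x) *
       (\<integral>\<^sup>+\<theta>. ennreal (tilted_lik y (1 / x) \<theta> * h \<theta>) \<partial>param_lebesgue) \<partial>lborel)"
proof -
  have "ennreal (exp (- (1 / x - 1) * (\<Sum>i\<in>UNIV. \<theta> i))) * (indicator param_space \<theta> * ennreal (tilted_lik y 1 \<theta> * h \<theta>))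
      = ennreal (tilted_lik y (1 / x) \<theta> * h \<theta>)" for x and \<theta> :: "'n \<Rightarrow> real"
  proof (cases "\<theta> \<in> param_space")
    case True
    have "exp (- (1 / x - 1) * (\<Sum>i\<in>UNIV. \<theta> i)) * (tilted_lik y 1 \<theta> * h \<theta>) = tilted_lik y (1 / x) \<theta> * h \<theta>"
      using tilted_lik_shift[of y 1 \<theta> "1 / x - 1"] by (simp add: mult_ac)
    thus ?thesis using True by (simp only: indicator_simps mult_1 ennreal_mult'[symmetric] exp_ge_zero)
  qed (simp add: tilted_lik_outside)
  thus ?thesis by (subst nn_integral_prior) simp_all
qed

text \<open>
  A common last step for the three posterior moments below: once the inner integral is known, only
  the comparison of integrands remains. The two integrands may differ at x = 0.
\<close>
lemma nn_integral_mixing: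
  assumes "0 < n" and f: "\<And>x. 0 < x \<Longrightarrow> x \<le> cutoff n \<Longrightarrow> 
      ennreal (mixing_density p n x) * f x = ennreal (a * taper_integrand (p - 2) n 2 m x)"
    and "0 \<le> a"
  shows "(\<integral>\<^sup>+x. ennreal (mixing_density p n x) * f x \<partial>lborel) = ennreal (a * taper_moment (p - 2) n 2 m)"
proof -
  have "(\<integral>\<^sup>+x. ennreal (mixing_density p n x) * f x \<partial>lborel) =
     (\<integral>\<^sup>+x. ennreal a * (ennreal (taper_integrand (p - 2) n 2 m x) * indicator {0..cutoff n} x) \<partial>lborel)"
  proof (rule nn_integral_cong_AE)
    have "AE x in lborel. x \<noteq> (0::real)" by (rule AE_lborel_singleton)
    thus "AE x in lborel. ennreal (mixing_density p n x) * f x =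
       ennreal a * (ennreal (taper_integrand (p - 2) n 2 m x) * indicator {0..cutoff n} x)"
    proof eventually_elim
      case (elim x)
      show ?case
      proof (cases "0 < x \<and> x \<le> cutoff n")
        case True
        thus ?thesis using f[of x] \<open>0 \<le> a\<close> by (simp add: ennreal_mult')
      next
        case False
        hence "mixing_density p n x = 0" "x \<notin> {0..cutoff n}" using elim by (auto simp: mixing_density_def)
        thus ?thesis by simp
      qed
    qed
  qed
  also have "\<dots> = ennreal a * ennreal (taper_moment (p - 2) n 2 m)"
    by (simp add: nn_integral_cmult nn_integral_taper_moment[OF \<open>0 < n\<close>])
  finally show ?thesis using \<open>0 \<le> a\<close> by (simp add: ennreal_mult')
qed

lemma prior_likelihood:
  fixes y :: "'n::finite \<Rightarrow> nat"
  assumes "0 < n"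
  shows "(\<integral>\<^sup>+\<theta>. ennreal (tilted_lik y 1 \<theta>) \<partial>prior n) = ennreal (taper_moment (CARD('n) - 2) n 2 (total y))"
proof -
  have "(\<integral>\<^sup>+x. ennreal (mixing_density CARD('n) n x) *
       (\<integral>\<^sup>+\<theta>. ennreal (tilted_lik y (1 / x) \<theta> * 1) \<partial>param_lebesgue) \<partial>lborel) = ennreal (1 * taper_moment (CARD('n) - 2) n 2 (total y))"
  proof (rule nn_integral_mixing[OF assms])
    fix x :: real assume x: "0 < x" "x \<le> cutoff n"
    show "ennreal (mixing_density CARD('n) n x) * (\<integral>\<^sup>+\<theta>. ennreal (tilted_lik y (1 / x) \<theta> * 1) \<partial>param_lebesgue) =
       ennreal (1 * taper_integrand (CARD('n) - 2) n 2 (total y) x)"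
      using x by (simp add: nn_integral_tilted_lik mixing_density_nonneg flip: ennreal_mult)
        (simp add: mixing_density_def taper_integrand_def power_add power_divide mult.assoc)
  qed simp
  thus ?thesis using nn_integral_prior_tilted_lik[where h = "\<lambda>_. 1" and y = y and n = n] by simp
qed

lemma prior_likelihood_over_component:
  fixes y :: "'n::finite \<Rightarrow> nat"
  assumes "0 < n" "0 < y i"
  shows "(\<integral>\<^sup>+\<theta>. ennreal (tilted_lik y 1 \<theta> / \<theta> i) \<partial>prior n) =
    ennreal (taper_moment (CARD('n) - 2) n 2 (total y - 1) / real (y i))"
proof -
  have tot: "0 < total y" using assms(2) by (auto simp: total_def sum_pos2 intro!: Nat.gr0I)
  have "(\<integral>\<^sup>+x. ennreal (mixing_density CARD('n) n x) *
       (\<integral>\<^sup>+\<theta>. ennreal (tilted_lik y (1 / x) \<theta> * (1 / \<theta> i)) \<partial>param_lebesgue) \<partial>lborel) =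
      ennreal (1 / real (y i) * taper_moment (CARD('n) - 2) n 2 (total y - 1))"
  proof (rule nn_integral_mixing[OF assms(1)])
    fix x :: real assume x: "0 < x" "x \<le> cutoff n"
    have "total y + CARD('n) - 1 = (total y - 1) + CARD('n)" using tot by simp
    thus "ennreal (mixing_density CARD('n) n x) * (\<integral>\<^sup>+\<theta>. ennreal (tilted_lik y (1 / x) \<theta> * (1 / \<theta> i)) \<partial>param_lebesgue) =
       ennreal (1 / real (y i) * taper_integrand (CARD('n) - 2) n 2 (total y - 1) x)"
      using x assms
      by (simp add: nn_integral_tilted_lik_over_component mixing_density_nonneg flip: ennreal_mult)
        (simp add: mixing_density_def taper_integrand_def power_add power_divide mult.assoc)
  qed simp
  thus ?thesis using nn_integral_prior_tilted_lik[where h = "\<lambda>\<theta>. 1 / \<theta> i" and y = y and n = n] by simp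
qed

lemma prior_likelihood_over_sum:
  fixes y :: "'n::finite \<Rightarrow> nat"
  assumes "0 < n" "0 < total y" "2 \<le> CARD('n)"
  shows "(\<integral>\<^sup>+\<theta>. ennreal (tilted_lik y 1 \<theta> / (\<Sum>i\<in>UNIV. \<theta> i)) \<partial>prior n) =
    ennreal (taper_moment (CARD('n) - 2) n 2 (total y - 1) / real (total y + CARD('n) - 1))"
proof -
  have "(\<integral>\<^sup>+x. ennreal (mixing_density CARD('n) n x) *
       (\<integral>\<^sup>+\<theta>. ennreal (tilted_lik y (1 / x) \<theta> * (1 / (\<Sum>i\<in>UNIV. \<theta> i))) \<partial>param_lebesgue) \<partial>lborel) =
      ennreal (1 / real (total y + CARD('n) - 1) * taper_moment (CARD('n) - 2) n 2 (total y - 1))"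
  proof (rule nn_integral_mixing[OF assms(1)])
    fix x :: real assume x: "0 < x" "x \<le> cutoff n"
    have *: "x ^ (total y + CARD('n) - 1) = x ^ (total y - 1) * x ^ CARD('n)"
      using assms by (simp flip: power_add)
    show "ennreal (mixing_density CARD('n) n x) * (\<integral>\<^sup>+\<theta>. ennreal (tilted_lik y (1 / x) \<theta> * (1 / (\<Sum>i\<in>UNIV. \<theta> i))) \<partial>param_lebesgue) =
       ennreal (1 / real (total y + CARD('n) - 1) * taper_integrand (CARD('n) - 2) n 2 (total y - 1) x)"
      using x assms
      by (simp add: nn_integral_tilted_lik_over_sum mixing_density_nonneg flip: ennreal_mult)
        (simp add: mixing_density_def taper_integrand_def power_divide mult.assoc *[unfolded One_nat_def])
  qed simp
  thus ?thesis using nn_integral_prior_tilted_lik[where h = "\<lambda>\<theta>. 1 / (\<Sum>i\<in>UNIV. \<theta> i)" and y = y and n = n] by simp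
qed

text \<open>
  Without the taper the mixture has mass equal to the integral of 1 / (1 - x)^2 over (0, 1), which
  diverges at 1; stopping at the cutoff makes it finite.
\<close>
lemma emeasure_prior_finite:
  assumes "0 < n" "2 \<le> CARD('n::finite)"
  shows "emeasure (prior n :: ('n \<Rightarrow> real) measure) UNIV < \<infinity>"
proof -
  let ?k = "mixing_density CARD('n) n"
  let ?L = "param_lebesgue :: ('n \<Rightarrow> real) measure"
  have "emeasure (prior n :: ('n \<Rightarrow> real) measure) UNIV = (\<integral>\<^sup>+\<theta>. 1 \<partial>(prior n :: ('n \<Rightarrow> real) measure))"
    by simp
  also have "\<dots> = (\<integral>\<^sup>+x. ennreal (?k x) *
     (\<integral>\<^sup>+\<theta>. ennreal (exp (- (1 / x - 1) * (\<Sum>i\<in>UNIV. \<theta> i))) * (indicator param_space \<theta> * 1) \<partial>?L) \<partial>lborel)"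
    by (rule nn_integral_prior) simp
  also have "\<dots> \<le> (\<integral>\<^sup>+x. ennreal (1 / (1 - cutoff n)\<^sup>2) * indicator {0..cutoff n} x \<partial>lborel)"
  proof (rule nn_integral_mono)
    fix x :: real
    show "ennreal (?k x) *
     (\<integral>\<^sup>+\<theta>. ennreal (exp (- (1 / x - 1) * (\<Sum>i\<in>UNIV. \<theta> i))) * (indicator param_space \<theta> * 1) \<partial>?L) \<le>
     ennreal (1 / (1 - cutoff n)\<^sup>2) * indicator {0..cutoff n} x"
    proof (cases "0 < x \<and> x \<le> cutoff n")
      case True
      hence x: "0 < x" "x \<le> cutoff n" "x < 1" using cutoff_bounds[of n] by auto
      define u where "u = 1 / x - 1"
      have u: "u = (1 - x) / x" "0 < u" using x by (simp_all add: u_def field_simps)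
      have "(\<integral>\<^sup>+\<theta>. ennreal (exp (- u * (\<Sum>i\<in>UNIV. \<theta> i))) * (indicator param_space \<theta> * 1) \<partial>?L) =
        (\<integral>\<^sup>+\<theta>. ennreal (tilted_lik (\<lambda>_. 0) u \<theta>) \<partial>?L)"
      proof (rule nn_integral_cong)
        fix \<theta> :: "'n \<Rightarrow> real"
        have "tilted_lik (\<lambda>_. 0) 0 \<theta> = indicator param_space \<theta>"
          by (auto simp: tilted_lik_def gamma_kernel_def param_space_def split: split_indicator)
        thus "ennreal (exp (- u * (\<Sum>i\<in>UNIV. \<theta> i))) * (indicator param_space \<theta> * 1) = ennreal (tilted_lik (\<lambda>_. 0) u \<theta>)"
          using tilted_lik_shift[of "\<lambda>_. 0" 0 \<theta> u] by (auto split: split_indicator)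
      qed
      also have "\<dots> = ennreal (1 / u ^ CARD('n))"
        using nn_integral_tilted_lik[of u "\<lambda>_::'n. 0"] u by (simp add: total_def)
      finally have "ennreal (?k x) * (\<integral>\<^sup>+\<theta>. ennreal (exp (- (1 / x - 1) * (\<Sum>i\<in>UNIV. \<theta> i))) * (indicator param_space \<theta> * 1) \<partial>?L)
         = ennreal (?k x * (1 / u ^ CARD('n)))"
        by (simp only: u_def ennreal_mult'[OF mixing_density_nonneg])
      also have "?k x * (1 / u ^ CARD('n)) = (log_taper n x)\<^sup>2 / (1 - x)\<^sup>2"
      proof -
        have "(1 - x) ^ CARD('n) = (1 - x) ^ (CARD('n) - 2) * (1 - x)\<^sup>2"
          using power_add[of "1 - x" "CARD('n) - 2" 2] assms(2) by (simp only: le_add_diff_inverse2)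
        thus ?thesis using x by (simp add: mixing_density_def u(1) power_divide)
      qed
      also have "(log_taper n x)\<^sup>2 / (1 - x)\<^sup>2 \<le> 1 / (1 - cutoff n)\<^sup>2"
      proof (rule frac_le)
        have "ln (1 - x) / real n \<le> 0" using x by (intro divide_nonpos_nonneg) auto
        hence "log_taper n x \<le> 1" by (simp add: log_taper_def)
        thus "(log_taper n x)\<^sup>2 \<le> 1" using log_taper_nonneg[OF assms(1) x(2)] by (simp add: power_le_one)
        show "(1 - cutoff n)\<^sup>2 \<le> (1 - x)\<^sup>2" using x cutoff_bounds[of n] by (intro power_mono) auto
      qed (use cutoff_bounds[of n] in auto)
      finally show ?thesis using x by (simp add: ennreal_leI)
    qed (auto simp: mixing_density_def)
  qed
  also have "\<dots> = ennreal (1 / (1 - cutoff n)\<^sup>2) * ennreal (cutoff n)"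
    using cutoff_bounds[of n] by (simp add: nn_integral_cmult)
  also have "\<dots> < \<infinity>" by (simp flip: ennreal_mult')
  finally show ?thesis .
qed

text \<open>
  A negative binomial series, obtained here without counting the observations with a given total:
  each term is an integral of a tilted likelihood divided by \<psi>, and summing the likelihoods over all
  observations gives 1 under the integral sign.
\<close>
lemma count_sum_power:
  assumes "0 < x" "x < 1" "2 \<le> CARD('n::finite)"
  shows "(\<integral>\<^sup>+y. ennreal (x ^ total y / real (total y + CARD('n) - 1)) \<partial>count_space (UNIV :: ('n \<Rightarrow> nat) set)) =
    ennreal (1 / (real (CARD('n) - 1) * (1 - x) ^ (CARD('n) - 1)))"
proof -
  let ?L = "param_lebesgue :: ('n \<Rightarrow> real) measure"
  let ?C = "count_space (UNIV :: ('n \<Rightarrow> nat) set)"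
  define u where "u = 1 / x - 1"
  have u: "u = (1 - x) / x" "0 < u" using assms by (simp_all add: u_def field_simps)
  let ?e = "\<lambda>\<theta>. exp (- u * (\<Sum>i\<in>UNIV. \<theta> i)) / (\<Sum>i\<in>UNIV. \<theta> i)"
  \<comment> \<open>the factor by which the gamma integral differs from the required term\<close>
  define b where "b = x ^ (CARD('n) - 1)"
  have b: "0 < b" using assms by (simp add: b_def)
  have "ennreal b * (\<integral>\<^sup>+y. ennreal (x ^ total y / real (total y + CARD('n) - 1)) \<partial>?C) =
     (\<integral>\<^sup>+y. (\<integral>\<^sup>+\<theta>. ennreal (tilted_lik y (1 / x) \<theta> / (\<Sum>i\<in>UNIV. \<theta> i)) \<partial>?L) \<partial>?C)"
  proof -
    have "ennreal b * ennreal (x ^ total y / real (total y + CARD('n) - 1)) =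
       (\<integral>\<^sup>+\<theta>. ennreal (tilted_lik y (1 / x) \<theta> / (\<Sum>i\<in>UNIV. \<theta> i)) \<partial>?L)" for y :: "'n \<Rightarrow> nat"
    proof -
      have "x ^ (total y + CARD('n) - 1) = x ^ total y * b"
        using assms by (simp add: b_def flip: power_add)
      thus ?thesis using assms b
        by (simp add: nn_integral_tilted_lik_over_sum power_divide mult_ac flip: ennreal_mult)
    qed
    thus ?thesis by (subst nn_integral_cmult[symmetric]) (auto intro!: nn_integral_cong)
  qed
  also have "\<dots> = (\<integral>\<^sup>+\<theta>. (\<integral>\<^sup>+y. ennreal (tilted_lik y (1 / x) \<theta> / (\<Sum>i\<in>UNIV. \<theta> i)) \<partial>?C) \<partial>?L)"
    by (rule nn_integral_count_space_nn_integral[symmetric]) auto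
  also have "\<dots> = (\<integral>\<^sup>+\<theta>. ennreal (tilted_lik (\<lambda>_. 0) u \<theta> / (\<Sum>i\<in>UNIV. \<theta> i)) \<partial>?L)"
  proof (rule nn_integral_cong)
    fix \<theta> :: "'n \<Rightarrow> real"
    show "(\<integral>\<^sup>+y. ennreal (tilted_lik y (1 / x) \<theta> / (\<Sum>i\<in>UNIV. \<theta> i)) \<partial>?C) =
      ennreal (tilted_lik (\<lambda>_. 0) u \<theta> / (\<Sum>i\<in>UNIV. \<theta> i))"
    proof (cases "\<theta> \<in> param_space")
      case True
      hence pos: "0 < (\<Sum>i\<in>UNIV. \<theta> i)" by (auto simp: param_space_def intro!: sum_pos)
      have "tilted_lik y (1 / x) \<theta> / (\<Sum>i\<in>UNIV. \<theta> i) = pmf (poisson_vec \<theta>) y * ?e \<theta>" for y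
        using tilted_lik_shift[of y 1 \<theta> u] by (simp add: pmf_poisson_vec[OF True] u_def)
      hence "(\<integral>\<^sup>+y. ennreal (tilted_lik y (1 / x) \<theta> / (\<Sum>i\<in>UNIV. \<theta> i)) \<partial>?C) =
         (\<integral>\<^sup>+y. ennreal (pmf (poisson_vec \<theta>) y) * ennreal (?e \<theta>) \<partial>?C)"
        by (simp only: ennreal_mult'[OF pmf_nonneg])
      also have "\<dots> = (\<integral>\<^sup>+y. ennreal (?e \<theta>) \<partial>measure_pmf (poisson_vec \<theta>))"
        by (rule nn_integral_measure_pmf[symmetric])
      also have "\<dots> = ennreal (?e \<theta>)" by simp
      also have "?e \<theta> = tilted_lik (\<lambda>_. 0) u \<theta> / (\<Sum>i\<in>UNIV. \<theta> i)"
      proof -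
        have "tilted_lik (\<lambda>_. 0) 0 \<theta> = 1" using True by (simp add: tilted_lik_def gamma_kernel_def param_space_def)
        thus ?thesis using tilted_lik_shift[of "\<lambda>_. 0" 0 \<theta> u] by simp
      qed
      finally show ?thesis .
    qed (simp add: tilted_lik_outside)
  qed
  also have "\<dots> = ennreal (1 / (real (CARD('n) - 1) * u ^ (CARD('n) - 1)))"
    using nn_integral_tilted_lik_over_sum[of u "\<lambda>_::'n. 0"] u assms by (simp add: total_def)
  also have "\<dots> = ennreal b * ennreal (1 / (real (CARD('n) - 1) * (1 - x) ^ (CARD('n) - 1)))"
    using b assms by (simp add: u(1) b_def power_divide flip: ennreal_mult)
  finally show ?thesis
    using b by (subst (asm) ennreal_mult_cancel_left) auto
qed

text \<open>
  After summation over y the integrand is at most 1 / (1 - x), and the cutoff is placed so that its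
  integral is exactly n. The gains carry the factor 1 / n^2, so their sum is O(1/n).
\<close>
lemma count_sum_taper_moment:
  assumes "0 < n" "2 \<le> CARD('n::finite)"
  shows "(\<integral>\<^sup>+y. ennreal (taper_moment (CARD('n) - 2) n 0 (total y + 1) / real (total y + CARD('n) - 1))
      \<partial>count_space (UNIV :: ('n \<Rightarrow> nat) set)) \<le> ennreal (real n)"
proof -
  let ?C = "count_space (UNIV :: ('n \<Rightarrow> nat) set)"
  let ?q = "CARD('n) - 2"
  have "(\<integral>\<^sup>+y. ennreal (taper_moment ?q n 0 (total y + 1) / real (total y + CARD('n) - 1)) \<partial>?C) =
     (\<integral>\<^sup>+y. (\<integral>\<^sup>+x. ennreal (1 / real (total y + CARD('n) - 1)) * 
         (ennreal (taper_integrand ?q n 0 (total y + 1) x) * indicator {0..cutoff n} x) \<partial>lborel) \<partial>?C)"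
    by (rule nn_integral_cong)
      (simp add: nn_integral_cmult nn_integral_taper_moment[OF assms(1)] taper_moment_nonneg[OF assms(1)] flip: ennreal_mult)
  also have "\<dots> = (\<integral>\<^sup>+x. (\<integral>\<^sup>+y. ennreal (1 / real (total y + CARD('n) - 1)) * 
         (ennreal (taper_integrand ?q n 0 (total y + 1) x) * indicator {0..cutoff n} x) \<partial>?C) \<partial>lborel)"
    by (rule nn_integral_count_space_nn_integral[symmetric]) auto
  also have "\<dots> \<le> (\<integral>\<^sup>+x. ennreal (1 / (1 - x)) * indicator {0..cutoff n} x \<partial>lborel)"
  proof (rule nn_integral_mono_AE)
    have "AE x in lborel. x \<noteq> (0::real)" by (rule AE_lborel_singleton)
    thus "AE x in lborel. (\<integral>\<^sup>+y. ennreal (1 / real (total y + CARD('n) - 1)) * 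
         (ennreal (taper_integrand ?q n 0 (total y + 1) x) * indicator {0..cutoff n} x) \<partial>?C)
        \<le> ennreal (1 / (1 - x)) * indicator {0..cutoff n} x"
    proof eventually_elim
      case (elim x)
      show ?case
      proof (cases "x \<in> {0..cutoff n}")
        case True
        hence x: "0 < x" "x < 1" using elim cutoff_bounds[of n] by auto
        have "(\<integral>\<^sup>+y. ennreal (1 / real (total y + CARD('n) - 1)) * 
           (ennreal (taper_integrand ?q n 0 (total y + 1) x) * indicator {0..cutoff n} x) \<partial>?C) =
           (\<integral>\<^sup>+y. ennreal ((1 - x) ^ ?q * x) * ennreal (x ^ total y / real (total y + CARD('n) - 1)) \<partial>?C)"
          using True x by (intro nn_integral_cong)
            (simp add: taper_integrand_def mult_ac flip: ennreal_mult)
        also have "\<dots> = ennreal ((1 - x) ^ ?q * x) * ennreal (1 / (real (CARD('n) - 1) * (1 - x) ^ (CARD('n) - 1)))"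
          using count_sum_power[OF x assms(2)] by (simp add: nn_integral_cmult)
        also have "\<dots> = ennreal (((1 - x) ^ ?q * x) * (1 / (real (CARD('n) - 1) * (1 - x) ^ (CARD('n) - 1))))"
          by (rule ennreal_mult'[symmetric]) (use x in simp)
        also have "((1 - x) ^ ?q * x) * (1 / (real (CARD('n) - 1) * (1 - x) ^ (CARD('n) - 1))) =
            x / real (CARD('n) - 1) * (1 / (1 - x))"
        proof -
          have "CARD('n) - 1 = Suc ?q" using assms by simp
          hence "(1 - x) ^ (CARD('n) - 1) = (1 - x) ^ ?q * (1 - x)" by simp
          thus ?thesis using x by simp
        qed
        also have "\<dots> \<le> 1 * (1 / (1 - x))"
          using x assms by (intro mult_right_mono) (auto simp: divide_le_eq_1)
        finally show ?thesis using True by (simp add: ennreal_leI)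
      qed simp
    qed
  qed
  also have "\<dots> = ennreal (- ln (1 - cutoff n) - (- ln (1 - 0)))"
  proof (rule nn_integral_FTC_Icc)
    fix x assume "x \<in> {0..cutoff n}" 
    hence "x < 1" using cutoff_bounds[of n] by auto
    thus "DERIV (\<lambda>x. - ln (1 - x)) x :> 1 / (1 - x)" "0 \<le> 1 / (1 - x)"
      by (auto intro!: derivative_eq_intros simp: field_simps)
  qed (use cutoff_bounds[of n] in auto)
  also have "\<dots> = ennreal (real n)" by (simp add: cutoff_def)
  finally show ?thesis .
qed


section \<open>The risk of the estimator\<close>
lemma poisson_moment_sums:
  fixes t :: real
  defines "w \<equiv> \<lambda>k::nat. t ^ k / fact k * exp (- t)"
  shows "w sums 1" "(\<lambda>k. real k * w k) sums t" "(\<lambda>k. (real k - t)\<^sup>2 * w k) sums t"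
proof -
  have "(\<lambda>k. t ^ k / fact k) sums exp t"
    using exp_converges[of t] by (simp add: scaleR_conv_of_real field_simps)
  from sums_mult2[OF this, of "exp (- t)"] show w1: "w sums 1"
    by (simp add: w_def flip: exp_add)
  have step: "real (Suc k) * w (Suc k) = t * w k" for k
    unfolding w_def by (simp add: divide_simps del: of_nat_Suc)
  have "(\<lambda>k. real (Suc k) * w (Suc k)) sums (t * 1)"
    unfolding step by (rule sums_mult[OF w1])
  from sums_Suc[OF this] show w2: "(\<lambda>k. real k * w k) sums t" by simp
  have step2: "real (Suc k) * (real (Suc k) - 1) * w (Suc k) = t * (real k * w k)" for k
  proof -
    have "real (Suc k) * (real (Suc k) - 1) * w (Suc k) = real k * (real (Suc k) * w (Suc k))"
      by simp
    thus ?thesis unfolding step by simp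
  qed
  have "(\<lambda>k. real (Suc k) * (real (Suc k) - 1) * w (Suc k)) sums (t * t)"
    unfolding step2 by (rule sums_mult[OF w2])
  from sums_Suc[OF this] have w3: "(\<lambda>k. real k * (real k - 1) * w k) sums (t * t)" by simp
  have "(\<lambda>k. real k * (real k - 1) * w k + (1 - 2 * t) * (real k * w k) + t\<^sup>2 * w k) sums
      (t * t + (1 - 2 * t) * t + t\<^sup>2 * 1)"
    by (intro sums_add sums_mult w1 w2 w3)
  thus "(\<lambda>k. (real k - t)\<^sup>2 * w k) sums t"
    by (simp add: algebra_simps power2_eq_square)
qed

lemma nn_integral_poisson:
  fixes t :: real
  assumes "0 < t" "0 \<le> a" "0 \<le> b"
  shows "(\<integral>\<^sup>+k. ennreal ((a * (real k - t)\<^sup>2 + b * real k) / t) \<partial>measure_pmf (poisson_pmf t)) = ennreal (a + b)"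
proof -
  let ?w = "\<lambda>k::nat. t ^ k / fact k * exp (- t)"
  have "(\<lambda>k. (a * ((real k - t)\<^sup>2 * ?w k) + b * (real k * ?w k)) / t) sums ((a * t + b * t) / t)"
    by (intro sums_divide sums_add sums_mult poisson_moment_sums)
  hence s: "(\<lambda>k. ?w k * ((a * (real k - t)\<^sup>2 + b * real k) / t)) sums (a + b)"
    using assms by (simp add: algebra_simps add_divide_distrib)
  have "(\<integral>\<^sup>+k. ennreal ((a * (real k - t)\<^sup>2 + b * real k) / t) \<partial>measure_pmf (poisson_pmf t)) =
     (\<Sum>k. ennreal (?w k * ((a * (real k - t)\<^sup>2 + b * real k) / t)))"
    unfolding nn_integral_measure_pmf nn_integral_count_space_nat using assms
    by (intro suminf_cong, subst ennreal_mult[symmetric]) auto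
  also have "\<dots> = ennreal (a + b)"
    by (rule suminf_ennreal_eq[OF _ s]) (use assms in auto)
  finally show ?thesis .
qed

lemma nn_integral_poisson_vec_component:
  fixes \<theta> :: "'n::finite \<Rightarrow> real"
  shows "(\<integral>\<^sup>+y. f (y i) \<partial>measure_pmf (poisson_vec \<theta>)) = (\<integral>\<^sup>+k. f k \<partial>measure_pmf (poisson_pmf (\<theta> i)))"
proof -
  have "map_pmf (\<lambda>y. y i) (poisson_vec \<theta>) = poisson_pmf (\<theta> i)"
    unfolding poisson_vec_def by (subst Pi_pmf_component) auto
  thus ?thesis by (metis nn_integral_map_pmf)
qed

text \<open>
  A form of the Cauchy--Schwarz inequality. It bounds the loss on the total by the loss on the
  components, and later the squared change in the total by the weighted squared changes of the
  components.
\<close>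
lemma square_sum_div_le:
  fixes a b :: "'a \<Rightarrow> real"
  assumes "\<And>i. i \<in> A \<Longrightarrow> 0 < b i"
  shows "(\<Sum>i\<in>A. a i)\<^sup>2 \<le> (\<Sum>i\<in>A. (a i)\<^sup>2 / b i) * (\<Sum>i\<in>A. b i)"
proof -
  have "(\<Sum>i\<in>A. a i / sqrt (b i) * sqrt (b i))\<^sup>2 \<le> (\<Sum>i\<in>A. (a i / sqrt (b i))\<^sup>2) * (\<Sum>i\<in>A. (sqrt (b i))\<^sup>2)"
    by (rule Cauchy_Schwarz_ineq_sum)
  moreover have "(\<Sum>i\<in>A. a i / sqrt (b i) * sqrt (b i)) = (\<Sum>i\<in>A. a i)"
    by (rule sum.cong) (use assms in \<open>auto dest!: less_imp_neq[OF assms]\<close>)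
  moreover have "(\<Sum>i\<in>A. (a i / sqrt (b i))\<^sup>2) = (\<Sum>i\<in>A. (a i)\<^sup>2 / b i)"
    by (rule sum.cong) (use assms in \<open>auto simp: power_divide less_imp_le\<close>)
  moreover have "(\<Sum>i\<in>A. (sqrt (b i))\<^sup>2) = (\<Sum>i\<in>A. b i)"
    by (rule sum.cong) (use assms in \<open>auto simp: less_imp_le\<close>)
  ultimately show ?thesis by simp
qed

lemma sum_param_pos: "\<theta> \<in> param_space \<Longrightarrow> 0 < (\<Sum>i\<in>UNIV. \<theta> i)"
  by (auto simp: param_space_def intro!: sum_pos)

lemma std_loss_le_loss:
  assumes "0 \<le> c" "\<theta> \<in> param_space"
  shows "std_loss \<theta> d \<le> loss c \<theta> d"
  using assms sum_param_pos[OF assms(2)] by (simp add: loss_def std_loss_def)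

lemma std_loss_nonneg: "\<theta> \<in> param_space \<Longrightarrow> 0 \<le> std_loss \<theta> d"
  unfolding std_loss_def param_space_def by (rule sum_nonneg) (auto simp: less_imp_le)

lemma loss_le_std_loss:
  assumes "0 \<le> c" "\<theta> \<in> param_space"
  shows "loss c \<theta> d \<le> (1 + c) * std_loss \<theta> d"
proof -
  have "((\<Sum>i\<in>UNIV. d i) - (\<Sum>i\<in>UNIV. \<theta> i))\<^sup>2 \<le> std_loss \<theta> d * (\<Sum>i\<in>UNIV. \<theta> i)"
    using square_sum_div_le[of UNIV \<theta> "\<lambda>i. d i - \<theta> i"] assms(2)
    by (simp add: std_loss_def param_space_def sum_subtractf)
  hence "((\<Sum>i\<in>UNIV. d i) - (\<Sum>i\<in>UNIV. \<theta> i))\<^sup>2 / (\<Sum>i\<in>UNIV. \<theta> i) \<le> std_loss \<theta> d"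
    using sum_param_pos[OF assms(2)] by (simp add: divide_le_eq)
  from mult_left_mono[OF this assms(1)] show ?thesis
    by (simp add: loss_def std_loss_def algebra_simps)
qed

lemma component_le_total: "y i \<le> total y"
  unfolding total_def by (rule member_le_sum) auto

text \<open>
  The estimator subtracts from y i an amount r that is at most y i and at most p - 1, so r^2 is at
  most (p - 1) y i. The expectation of this bound is proportional to \<theta> i, so it survives the
  division by \<theta> i in the loss, however small \<theta> i is.
\<close>
lemma delta_c_square_error:
  fixes y :: "'n::finite \<Rightarrow> nat"
  assumes "0 \<le> c" "2 \<le> CARD('n)"
  shows "(delta_c c y i - t)\<^sup>2 \<le> 2 * (real (y i) - t)\<^sup>2 + 2 * (real CARD('n) - 1) * real (y i)"
proof -
  define D where "D = real CARD('n) - 1 + (1 + c) * real (total y)"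
  define r where "r = (real CARD('n) - 1) * real (y i) / D"
  have p: "0 < real CARD('n) - 1" using assms by simp
  have le: "real (y i) \<le> (1 + c) * real (total y)"
  proof -
    have "real (y i) \<le> real (total y)" using component_le_total[of y i] by simp
    also have "\<dots> \<le> (1 + c) * real (total y)" using assms by (simp add: algebra_simps)
    finally show ?thesis .
  qed
  have D: "0 < D" "real CARD('n) - 1 \<le> D" "real (y i) \<le> D" using p le by (auto simp: D_def)
  have d: "delta_c c y i = real (y i) - r" by (simp add: delta_c_def r_def D_def algebra_simps)
  have "r \<le> real (y i)" unfolding r_def using D p
    using mult_right_mono[OF D(2), of "real (y i)"] by (simp add: divide_le_eq mult.commute)
  moreover have "r \<le> real CARD('n) - 1" unfolding r_def using D p
    by (simp add: divide_le_eq mult_left_mono)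
  moreover have "0 \<le> r" using D p by (simp add: r_def)
  ultimately have "r * r \<le> (real CARD('n) - 1) * real (y i)" using p by (intro mult_mono) auto
  moreover have "0 \<le> (real (y i) - t + r)\<^sup>2" by simp
  hence "(real (y i) - r - t)\<^sup>2 \<le> 2 * (real (y i) - t)\<^sup>2 + 2 * (r * r)"
    by (simp add: power2_eq_square algebra_simps)
  ultimately have "(real (y i) - r - t)\<^sup>2 \<le> 2 * (real (y i) - t)\<^sup>2 + 2 * ((real CARD('n) - 1) * real (y i))"
    by linarith
  thus ?thesis unfolding d by (simp only: mult.assoc)
qed

lemma risk_delta_c_bounded:
  assumes "0 \<le> c" "2 \<le> CARD('n::finite)" "(\<theta> :: 'n \<Rightarrow> real) \<in> param_space"
  shows "risk (loss c) (delta_c c) \<theta> \<le> ennreal (2 * (1 + c) * (real CARD('n))\<^sup>2)"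
proof -
  let ?p = "real CARD('n)"
  let ?g = "\<lambda>i k. (2 * (real k - \<theta> i)\<^sup>2 + 2 * (?p - 1) * real k) / \<theta> i"
  have pos: "0 < \<theta> i" for i using assms(3) by (simp add: param_space_def)
  have p: "0 \<le> ?p - 1" using assms by simp
  have g: "0 \<le> ?g i k" for i k using pos[of i] p by simp
  have "risk (loss c) (delta_c c) \<theta> \<le>
     (\<integral>\<^sup>+y. ennreal (1 + c) * (\<Sum>i\<in>UNIV. ennreal (?g i (y i))) \<partial>measure_pmf (poisson_vec \<theta>))"
    unfolding risk_def
  proof (rule nn_integral_mono)
    fix y :: "'n \<Rightarrow> nat"
    have "loss c \<theta> (delta_c c y) \<le> (1 + c) * std_loss \<theta> (delta_c c y)"
      by (rule loss_le_std_loss) (use assms in auto)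
    also have "\<dots> \<le> (1 + c) * (\<Sum>i\<in>UNIV. ?g i (y i))"
      unfolding std_loss_def using assms pos
      by (intro mult_left_mono sum_mono divide_right_mono delta_c_square_error) (auto simp: less_imp_le)
    finally have "ennreal (loss c \<theta> (delta_c c y)) \<le> ennreal ((1 + c) * (\<Sum>i\<in>UNIV. ?g i (y i)))"
      by (rule ennreal_leI)
    thus "ennreal (loss c \<theta> (delta_c c y)) \<le> ennreal (1 + c) * (\<Sum>i\<in>UNIV. ennreal (?g i (y i)))"
      using assms g by (simp add: ennreal_mult' sum_ennreal)
  qed
  also have "\<dots> = ennreal (1 + c) * (\<Sum>i\<in>UNIV. \<integral>\<^sup>+y. ennreal (?g i (y i)) \<partial>measure_pmf (poisson_vec \<theta>))"
    by (simp add: nn_integral_cmult nn_integral_sum)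
  also have "\<dots> = ennreal (1 + c) * (\<Sum>i\<in>(UNIV::'n set). ennreal (2 + 2 * (?p - 1)))"
  proof -
    have "(\<integral>\<^sup>+y. ennreal (?g i (y i)) \<partial>measure_pmf (poisson_vec \<theta>)) = ennreal (2 + 2 * (?p - 1))" for i :: 'n
      using nn_integral_poisson_vec_component[where f = "\<lambda>k. ennreal (?g i k)" and i = i and \<theta> = \<theta>]
        nn_integral_poisson[OF pos[of i], of 2 "2 * (?p - 1)"] p by simp
    thus ?thesis by simp
  qed
  also have "\<dots> = ennreal (1 + c) * ennreal (\<Sum>i\<in>(UNIV::'n set). 2 + 2 * (?p - 1))"
    using p by (subst sum_ennreal) auto
  also have "\<dots> = ennreal ((1 + c) * (\<Sum>i\<in>(UNIV::'n set). 2 + 2 * (?p - 1)))"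
    by (rule ennreal_mult'[symmetric]) (use assms in simp)
  also have "(1 + c) * (\<Sum>i\<in>(UNIV::'n set). 2 + 2 * (?p - 1)) = 2 * (1 + c) * ?p\<^sup>2"
    by (simp add: power2_eq_square algebra_simps)
  finally show ?thesis .
qed

lemma risk_as_count_integral:
  assumes "\<theta> \<in> param_space"
  shows "risk L \<delta> \<theta> = (\<integral>\<^sup>+y. ennreal (tilted_lik y 1 \<theta> * L \<theta> (\<delta> y)) \<partial>count_space UNIV)"
  unfolding risk_def using assms
  by (simp add: nn_integral_measure_pmf pmf_poisson_vec ennreal_mult' tilted_lik_nonneg)

text \<open>
  If y i = 0, the likelihood of y stays bounded below as \<theta> i tends to 0 with the other coordinates
  fixed, while a nonzero estimate costs a multiple of 1 / \<theta> i. This confines rival estimators to the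
  support of the observation, where all posterior expectations are finite.
\<close>
lemma bounded_risk_imp_zero:
  fixes \<delta> :: "'n::finite estimator"
  assumes "0 \<le> c" "0 \<le> B" and B: "\<And>\<theta>. \<theta> \<in> param_space \<Longrightarrow> risk (loss c) \<delta> \<theta> \<le> ennreal B"
    and "y i = 0"
  shows "\<delta> y i = 0"
proof (rule ccontr)
  assume nz: "\<delta> y i \<noteq> 0"
  define d where "d = \<delta> y i"
  define \<kappa> where "\<kappa> = exp (- 1) * (\<Prod>j\<in>UNIV - {i}. gamma_kernel (y j) 1 1)"
  have \<kappa>: "0 < \<kappa>" unfolding \<kappa>_def
    by (intro mult_pos_pos prod_pos) (auto simp: gamma_kernel_def)
  \<comment> \<open>small enough for a coordinate t to make the single term of y exceed the bound B on the risk\<close>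
  define t where "t = min 1 (min (\<bar>d\<bar> / 2) (\<kappa> * d\<^sup>2 / (4 * (B + 1))))"
  have d: "0 < d\<^sup>2" "0 < \<bar>d\<bar>" using nz by (auto simp: d_def)
  have t: "0 < t" "t \<le> 1" "t \<le> \<bar>d\<bar> / 2" "t \<le> \<kappa> * d\<^sup>2 / (4 * (B + 1))"
    using d \<kappa> \<open>0 \<le> B\<close>
    by (simp_all only: t_def min.cobounded1 min.coboundedI2 min.cobounded2) (simp add: min_less_iff_conj)
  define \<theta> where "\<theta> = (\<lambda>j. if j = i then t else 1)"
  have \<theta>: "\<theta> \<in> param_space" using t by (auto simp: \<theta>_def param_space_def)
  \<comment> \<open>the error stays at least half the estimate, since t is at most half of it\<close>
  have "\<bar>d\<bar> / 2 \<le> \<bar>d - t\<bar>" using t by linarith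
  hence "(\<bar>d\<bar> / 2)\<^sup>2 \<le> (d - t)\<^sup>2" by (metis abs_ge_zero abs_le_square_iff abs_of_nonneg divide_nonneg_pos zero_less_numeral)
  hence sq: "d\<^sup>2 / 4 \<le> (d - t)\<^sup>2" by (simp add: power_divide)
  have "\<kappa> \<le> tilted_lik y 1 \<theta>"
  proof -
    have "tilted_lik y 1 \<theta> = gamma_kernel (y i) 1 (\<theta> i) * (\<Prod>j\<in>UNIV-{i}. gamma_kernel (y j) 1 (\<theta> j))"
      unfolding tilted_lik_def by (simp add: prod.remove[of UNIV i])
    also have "(\<Prod>j\<in>UNIV-{i}. gamma_kernel (y j) 1 (\<theta> j)) = (\<Prod>j\<in>UNIV - {i}. gamma_kernel (y j) 1 1)"
      by (rule prod.cong) (auto simp: \<theta>_def)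
    also have "gamma_kernel (y i) 1 (\<theta> i) = exp (- t)" using \<open>y i = 0\<close> t by (simp add: gamma_kernel_def \<theta>_def)
    finally show ?thesis using t unfolding \<kappa>_def by (auto intro!: mult_right_mono prod_nonneg gamma_kernel_nonneg)
  qed
  moreover have "d\<^sup>2 / 4 / t \<le> loss c \<theta> (\<delta> y)"
  proof -
    have "d\<^sup>2 / 4 / t \<le> (\<delta> y i - \<theta> i)\<^sup>2 / \<theta> i"
      using divide_right_mono[OF sq, of t] t by (simp add: \<theta>_def d_def)
    also have "\<dots> \<le> std_loss \<theta> (\<delta> y)"
      unfolding std_loss_def using \<theta>
      by (intro member_le_sum) (auto simp: param_space_def less_imp_le)
    also have "\<dots> \<le> loss c \<theta> (\<delta> y)" by (rule std_loss_le_loss) fact+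
    finally show ?thesis .
  qed
  ultimately have "\<kappa> * (d\<^sup>2 / 4 / t) \<le> tilted_lik y 1 \<theta> * loss c \<theta> (\<delta> y)"
    using \<kappa> t by (intro mult_mono) (auto simp: tilted_lik_nonneg)
  moreover have "B + 1 \<le> \<kappa> * (d\<^sup>2 / 4 / t)"
    using t \<open>0 \<le> B\<close> by (simp add: field_simps)
  ultimately have "B + 1 \<le> tilted_lik y 1 \<theta> * loss c \<theta> (\<delta> y)" by linarith
  hence "ennreal (B + 1) \<le> ennreal (tilted_lik y 1 \<theta> * loss c \<theta> (\<delta> y))" by (rule ennreal_leI)
  also have "\<dots> \<le> risk (loss c) \<delta> \<theta>"
    unfolding risk_as_count_integral[OF \<theta>] by (rule nn_integral_ge_point) simp
  also have "\<dots> \<le> ennreal B" by (rule B[OF \<theta>])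
  finally show False using \<open>0 \<le> B\<close> by (simp add: ennreal_le_iff)
qed


section \<open>Comparison of posterior losses\<close>
text \<open>
  The algebra behind the posterior comparison. The expression without its last term is the change in
  integrated loss when the estimate a y is altered: Q is the weighted squared change, \<sigma> the change in
  the sum of the estimates, P = p - 1, and m, C, S, T are the taper moments. The choice of a makes the
  terms linear in \<sigma> collapse to (1 + c) times the left-hand side of \<open>rec\<close>, hence to a small
  multiple of S; half of m Q and the last term together absorb it, by the inequality \<open>square\<close>.
\<close>
lemma quadratic_comparison:
  fixes m S T C Q \<sigma> Z P n c :: real
  assumes pos: "0 < Z" "0 < P" "0 < n" and "0 \<le> c" "0 \<le> m" "0 \<le> T"
    and rec: "Z * m - (Z + P) * C = 2 / n * S"
    and square: "\<And>a b. 0 \<le> a\<^sup>2 * m + 2 * a * b * S + b\<^sup>2 * T"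
    and \<sigma>: "\<sigma>\<^sup>2 \<le> Q * Z"
  defines "a \<equiv> (1 + c) * Z / (P + (1 + c) * Z)"
  shows "m * Q / 2 \<le> m * Q + 2 * a * \<sigma> * m - 2 * (1 + c) * \<sigma> * C
      + c * (\<sigma>\<^sup>2 + 2 * \<sigma> * (a * Z)) * (m / (Z + P)) + 8 * (1 + c)\<^sup>2 / n\<^sup>2 * (T / (Z + P))"
proof -
  define E where "E = Z + P"
  have E: "0 < E" "Z \<le> E" using pos by (auto simp: E_def)
  \<comment> \<open>chosen so that the mixed term 2 \<sigma> e S of the square, divided by 2 Z, is the linear term of the loss\<close>
  define e where "e = 4 * (1 + c) * Z / (n * E)"
  have den: "0 < P + (1 + c) * Z" using pos \<open>0 \<le> c\<close> by (simp add: add_pos_pos)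
  have "a * (E + c * Z) = (1 + c) * Z"
    using den by (simp add: a_def E_def field_simps)
  hence aE: "a * (1 + c * Z / E) = (1 + c) * Z / E"
    using E by (simp add: field_simps)
  have C: "Z * m / E - C = 2 * S / (n * E)"
  proof -
    have "Z * m / E - C = (Z * m - E * C) / E" using E by (simp add: field_simps)
    also have "Z * m - E * C = 2 / n * S" using rec by (simp only: E_def)
    finally show ?thesis by simp
  qed
  have "2 * a * \<sigma> * m - 2 * (1 + c) * \<sigma> * C + c * (\<sigma>\<^sup>2 + 2 * \<sigma> * (a * Z)) * (m / E)
     = c * \<sigma>\<^sup>2 * (m / E) + 2 * \<sigma> * (m * (a * (1 + c * Z / E)) - (1 + c) * C)"
    by (simp add: algebra_simps add_divide_distrib)
  also have "m * (a * (1 + c * Z / E)) - (1 + c) * C = (1 + c) * (Z * m / E - C)"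
    unfolding aE by (simp add: algebra_simps)
  also have "\<dots> = (1 + c) * (2 * S / (n * E))" unfolding C ..
  finally have lin: "2 * a * \<sigma> * m - 2 * (1 + c) * \<sigma> * C + c * (\<sigma>\<^sup>2 + 2 * \<sigma> * (a * Z)) * (m / E)
     = c * \<sigma>\<^sup>2 * (m / E) + e * \<sigma> * S / Z"
    using pos by (simp add: e_def)
  have "0 \<le> (\<sigma>\<^sup>2 * m + 2 * \<sigma> * e * S + e\<^sup>2 * T) / (2 * Z)"
    using square[of \<sigma> e] pos by simp
  also have "\<dots> = \<sigma>\<^sup>2 / Z * (m / 2) + e * \<sigma> * S / Z + e\<^sup>2 * T / (2 * Z)"
    using pos by (simp add: field_simps)
  also have "\<dots> \<le> Q * (m / 2) + e * \<sigma> * S / Z + 8 * (1 + c)\<^sup>2 / n\<^sup>2 * (T / E)"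
  proof -
    have "\<sigma>\<^sup>2 / Z * (m / 2) \<le> Q * (m / 2)"
      using \<sigma> pos \<open>0 \<le> m\<close> by (intro mult_right_mono) (auto simp: divide_le_eq)
    moreover have "e\<^sup>2 * T / (2 * Z) = 8 * (1 + c)\<^sup>2 / n\<^sup>2 * (T / E) * (Z / E)"
      using pos E by (simp add: e_def field_simps power2_eq_square)
    moreover have "8 * (1 + c)\<^sup>2 / n\<^sup>2 * (T / E) * (Z / E) \<le> 8 * (1 + c)\<^sup>2 / n\<^sup>2 * (T / E) * 1"
      using E pos \<open>0 \<le> T\<close> by (intro mult_left_mono) auto
    ultimately show ?thesis by linarith
  qed
  finally have "0 \<le> Q * (m / 2) + e * \<sigma> * S / Z + 8 * (1 + c)\<^sup>2 / n\<^sup>2 * (T / E)" .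
  moreover have "0 \<le> c * \<sigma>\<^sup>2 * (m / E)" using E \<open>0 \<le> c\<close> \<open>0 \<le> m\<close> by simp
  ultimately show ?thesis using lin unfolding E_def[symmetric] by (simp add: mult.commute)
qed

lemma weighted_loss_nonneg:
  "0 \<le> c \<Longrightarrow> 0 \<le> tilted_lik y 1 \<theta> * loss c \<theta> d"
  using std_loss_nonneg[of \<theta> d] std_loss_le_loss[of c \<theta> d] tilted_lik_outside[of \<theta> y 1]
  by (cases "\<theta> \<in> param_space") (auto simp: tilted_lik_nonneg)

lemma loss_measurable[measurable]:
  "(\<lambda>\<theta>. loss c \<theta> d) \<in> borel_measurable (param_lebesgue :: ('n::finite \<Rightarrow> real) measure)"
  unfolding loss_def by measurable

text \<open>
  In the difference of two losses the terms that do not involve the estimates cancel, so only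
  the posterior moments of 1, 1 / \<theta> i and 1 / \<psi> are needed; the restriction to y i > 0 is where the
  second of these is finite.
\<close>
lemma loss_difference:
  fixes y :: "'n::finite \<Rightarrow> nat"
  assumes "\<theta> \<in> param_space" and supp: "\<And>i. y i = 0 \<Longrightarrow> d i = 0" "\<And>i. y i = 0 \<Longrightarrow> d' i = 0"
  shows "loss c \<theta> d' - loss c \<theta> d =
    (\<Sum>i | 0 < y i. ((d' i - d i)\<^sup>2 + 2 * (d' i - d i) * d i) * (1 / \<theta> i))
    - 2 * (1 + c) * (\<Sum>i\<in>UNIV. d' i - d i)
    + c * ((\<Sum>i\<in>UNIV. d' i - d i)\<^sup>2 + 2 * (\<Sum>i\<in>UNIV. d' i - d i) * (\<Sum>i\<in>UNIV. d i)) * (1 / (\<Sum>i\<in>UNIV. \<theta> i))"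
proof -
  define \<psi> where "\<psi> = (\<Sum>i\<in>UNIV. \<theta> i)"
  define s where "s = (\<Sum>i\<in>UNIV. d i)"
  define s' where "s' = (\<Sum>i\<in>UNIV. d' i)"
  have \<psi>: "0 < \<psi>" unfolding \<psi>_def by (rule sum_param_pos) fact
  have pos: "0 < \<theta> i" for i using assms(1) by (simp add: param_space_def)
  have "(d' i - \<theta> i)\<^sup>2 / \<theta> i - (d i - \<theta> i)\<^sup>2 / \<theta> i =
      ((d' i - d i)\<^sup>2 + 2 * (d' i - d i) * d i) * (1 / \<theta> i) - 2 * (d' i - d i)" for i
    using pos[of i] by (simp add: field_simps power2_eq_square)
  hence "(\<Sum>i\<in>UNIV. (d' i - \<theta> i)\<^sup>2 / \<theta> i) - (\<Sum>i\<in>UNIV. (d i - \<theta> i)\<^sup>2 / \<theta> i) =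
      (\<Sum>i\<in>UNIV. ((d' i - d i)\<^sup>2 + 2 * (d' i - d i) * d i) * (1 / \<theta> i) - 2 * (d' i - d i))"
    by (simp add: sum_subtractf[symmetric])
  also have "\<dots> = (\<Sum>i\<in>UNIV. ((d' i - d i)\<^sup>2 + 2 * (d' i - d i) * d i) * (1 / \<theta> i)) - 2 * (s' - s)"
    by (simp only: sum_subtractf sum_distrib_left[symmetric] s_def s'_def)
  also have "(\<Sum>i\<in>UNIV. ((d' i - d i)\<^sup>2 + 2 * (d' i - d i) * d i) * (1 / \<theta> i)) =
      (\<Sum>i | 0 < y i. ((d' i - d i)\<^sup>2 + 2 * (d' i - d i) * d i) * (1 / \<theta> i))"
    by (rule sum.mono_neutral_right) (auto simp: supp)
  finally have 1: "(\<Sum>i\<in>UNIV. (d' i - \<theta> i)\<^sup>2 / \<theta> i) - (\<Sum>i\<in>UNIV. (d i - \<theta> i)\<^sup>2 / \<theta> i) =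
      (\<Sum>i | 0 < y i. ((d' i - d i)\<^sup>2 + 2 * (d' i - d i) * d i) * (1 / \<theta> i)) - 2 * (s' - s)" .
  have 2: "(s' - \<psi>)\<^sup>2 / \<psi> - (s - \<psi>)\<^sup>2 / \<psi> = ((s' - s)\<^sup>2 + 2 * (s' - s) * s) * (1 / \<psi>) - 2 * (s' - s)"
    using \<psi> by (simp add: field_simps power2_eq_square)
  have "loss c \<theta> d' - loss c \<theta> d =
    ((\<Sum>i\<in>UNIV. (d' i - \<theta> i)\<^sup>2 / \<theta> i) - (\<Sum>i\<in>UNIV. (d i - \<theta> i)\<^sup>2 / \<theta> i))
    + c * ((s' - \<psi>)\<^sup>2 / \<psi> - (s - \<psi>)\<^sup>2 / \<psi>)"
    by (simp add: loss_def s_def s'_def \<psi>_def algebra_simps)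
  thus ?thesis unfolding 1 2 by (simp add: sum_subtractf s_def s'_def \<psi>_def algebra_simps)
qed

text \<open>
  The squared distance on the left is what lets the limit conclude that two estimates are equal.
  The bound for the gain on the right depends on neither estimate, so it can be summed over y. The two
  finiteness assumptions allow the integrated losses to be subtracted.
\<close>

lemma posterior_loss_comparison:
  fixes y :: "'n::finite \<Rightarrow> nat" and d' :: "'n \<Rightarrow> real"
  assumes c: "0 \<le> c" and p: "2 \<le> CARD('n)" and n: "0 < n" and Z: "0 < total y"
    and supp: "\<And>i. y i = 0 \<Longrightarrow> d' i = 0"
    and fin: "(\<integral>\<^sup>+\<theta>. ennreal (tilted_lik y 1 \<theta> * loss c \<theta> (delta_c c y)) \<partial>prior n) < \<infinity>"
    and fin': "(\<integral>\<^sup>+\<theta>. ennreal (tilted_lik y 1 \<theta> * loss c \<theta> d') \<partial>prior n) < \<infinity>"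
  shows "(\<integral>\<^sup>+\<theta>. ennreal (tilted_lik y 1 \<theta> * loss c \<theta> (delta_c c y)) \<partial>prior n)
      + ennreal (taper_moment (CARD('n) - 2) n 2 (total y - 1) * (\<Sum>i | 0 < y i. (d' i - delta_c c y i)\<^sup>2 / real (y i)) / 2)
    \<le> (\<integral>\<^sup>+\<theta>. ennreal (tilted_lik y 1 \<theta> * loss c \<theta> d') \<partial>prior n)
      + ennreal (8 * (1 + c)\<^sup>2 / (real n)\<^sup>2 *
          (taper_moment (CARD('n) - 2) n 0 (total y + 1) / real (total y + CARD('n) - 1)))"
proof -
  let ?\<mu> = "prior n :: ('n \<Rightarrow> real) measure"
  let ?q = "CARD('n) - 2"
  define G where "G = (tilted_lik y 1 :: ('n \<Rightarrow> real) \<Rightarrow> real)"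
  define d where "d = delta_c c y"
  define P where "P = real CARD('n) - 1"
  define ZZ where "ZZ = real (total y)"
  define a where "a = (1 + c) * ZZ / (P + (1 + c) * ZZ)"
  define m where "m = taper_moment ?q n 2 (total y - 1)"
  define C where "C = taper_moment ?q n 2 (total y)"
  define T where "T = taper_moment ?q n 0 (total y + 1)"
  define \<sigma> where "\<sigma> = (\<Sum>i\<in>UNIV. d' i - d i)"
  define s where "s = (\<Sum>i\<in>UNIV. d i)"
  define Q where "Q = (\<Sum>i | 0 < y i. (d' i - d i)\<^sup>2 / real (y i))"
  have [measurable]: "G \<in> borel_measurable param_lebesgue" by (simp add: G_def)
  have P: "0 < P" using p by (simp add: P_def)
  have ZP: "real (total y + CARD('n) - 1) = ZZ + P" using Z by (simp add: ZZ_def P_def)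
  have Z0: "0 < ZZ" using Z by (simp add: ZZ_def)
  have d: "d i = a * real (y i)" for i
  proof -
    have "0 < P + (1 + c) * ZZ" using P Z0 c by (simp add: add_pos_pos)
    thus ?thesis by (simp add: d_def delta_c_def a_def P_def[symmetric] ZZ_def[symmetric] field_simps)
  qed
  have s: "s = a * ZZ" by (simp add: s_def d ZZ_def total_def sum_distrib_left)
  have m0: "0 \<le> m" "0 \<le> T" unfolding m_def T_def by (rule taper_moment_nonneg[OF n])+

  have nn: "AE \<theta> in ?\<mu>. 0 \<le> G \<theta> * loss c \<theta> e" for e
    by (simp add: G_def weighted_loss_nonneg[OF c])
  have int: "integrable ?\<mu> (\<lambda>\<theta>. G \<theta> * loss c \<theta> d)"
    by (rule integrableI_nonneg) (use fin nn in \<open>auto simp: G_def d_def\<close>)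
  have int': "integrable ?\<mu> (\<lambda>\<theta>. G \<theta> * loss c \<theta> d')"
    by (rule integrableI_nonneg) (use fin' nn in \<open>auto simp: G_def\<close>)

  have G_nonneg: "0 \<le> G \<theta>" for \<theta> by (simp add: G_def tilted_lik_nonneg)
  have HC: "has_bochner_integral ?\<mu> G C"
    by (rule has_bochner_integral_nn_integral)
      (use prior_likelihood[OF n, of y] in \<open>auto simp: G_def tilted_lik_nonneg C_def taper_moment_nonneg[OF n]\<close>)
  have HA: "has_bochner_integral ?\<mu> (\<lambda>\<theta>. G \<theta> / \<theta> i) (m / real (y i))" if i: "0 < y i" for i
  proof (rule has_bochner_integral_nn_integral)
    show "AE \<theta> in ?\<mu>. 0 \<le> G \<theta> / \<theta> i"
    proof (rule AE_I2)
      fix \<theta> :: "'n \<Rightarrow> real"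
      show "0 \<le> G \<theta> / \<theta> i"
        by (cases "\<theta> \<in> param_space") (auto simp: G_def tilted_lik_outside tilted_lik_nonneg param_space_def less_imp_le)
    qed
    show "(\<integral>\<^sup>+\<theta>. ennreal (G \<theta> / \<theta> i) \<partial>?\<mu>) = ennreal (m / real (y i))"
      unfolding G_def m_def by (rule prior_likelihood_over_component[where y = y and i = i, OF n i])
  qed (use m0 in auto)
  have HP: "has_bochner_integral ?\<mu> (\<lambda>\<theta>. G \<theta> / (\<Sum>i\<in>UNIV. \<theta> i)) (m / (ZZ + P))"
  proof (rule has_bochner_integral_nn_integral)
    show "AE \<theta> in ?\<mu>. 0 \<le> G \<theta> / (\<Sum>i\<in>UNIV. \<theta> i)"
    proof (rule AE_I2)
      fix \<theta> :: "'n \<Rightarrow> real"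
      show "0 \<le> G \<theta> / (\<Sum>i\<in>UNIV. \<theta> i)"
        using sum_param_pos[of \<theta>]
        by (cases "\<theta> \<in> param_space") (auto simp: G_def tilted_lik_outside tilted_lik_nonneg less_imp_le)
    qed
    show "(\<integral>\<^sup>+\<theta>. ennreal (G \<theta> / (\<Sum>i\<in>UNIV. \<theta> i)) \<partial>?\<mu>) = ennreal (m / (ZZ + P))"
      unfolding G_def m_def ZP[symmetric] by (rule prior_likelihood_over_sum[OF n Z p])
  qed (use m0 Z0 P in auto)

  let ?D = "(\<Sum>i | 0 < y i. ((d' i - d i)\<^sup>2 + 2 * (d' i - d i) * d i) * (m / real (y i)))
    - 2 * (1 + c) * \<sigma> * C + c * (\<sigma>\<^sup>2 + 2 * \<sigma> * s) * (m / (ZZ + P))"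
  have "has_bochner_integral ?\<mu> (\<lambda>\<theta>.
     (\<Sum>i | 0 < y i. ((d' i - d i)\<^sup>2 + 2 * (d' i - d i) * d i) * (G \<theta> / \<theta> i))
    - 2 * (1 + c) * \<sigma> * G \<theta> + c * (\<sigma>\<^sup>2 + 2 * \<sigma> * s) * (G \<theta> / (\<Sum>i\<in>UNIV. \<theta> i))) ?D"
    by (intro has_bochner_integral_add has_bochner_integral_diff has_bochner_integral_sum
        has_bochner_integral_mult_right HC HP HA) auto
  also have "(\<lambda>\<theta>. (\<Sum>i | 0 < y i. ((d' i - d i)\<^sup>2 + 2 * (d' i - d i) * d i) * (G \<theta> / \<theta> i))
    - 2 * (1 + c) * \<sigma> * G \<theta> + c * (\<sigma>\<^sup>2 + 2 * \<sigma> * s) * (G \<theta> / (\<Sum>i\<in>UNIV. \<theta> i)))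
    = (\<lambda>\<theta>. G \<theta> * loss c \<theta> d' - G \<theta> * loss c \<theta> d)"
  proof
    fix \<theta> :: "'n \<Rightarrow> real"
    show "(\<Sum>i | 0 < y i. ((d' i - d i)\<^sup>2 + 2 * (d' i - d i) * d i) * (G \<theta> / \<theta> i))
      - 2 * (1 + c) * \<sigma> * G \<theta> + c * (\<sigma>\<^sup>2 + 2 * \<sigma> * s) * (G \<theta> / (\<Sum>i\<in>UNIV. \<theta> i))
      = G \<theta> * loss c \<theta> d' - G \<theta> * loss c \<theta> d"
    proof (cases "\<theta> \<in> param_space")
      case True
      have "loss c \<theta> d' - loss c \<theta> d =
        (\<Sum>i | 0 < y i. ((d' i - d i)\<^sup>2 + 2 * (d' i - d i) * d i) * (1 / \<theta> i))
        - 2 * (1 + c) * \<sigma> + c * (\<sigma>\<^sup>2 + 2 * \<sigma> * s) * (1 / (\<Sum>i\<in>UNIV. \<theta> i))"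
        unfolding \<sigma>_def s_def by (rule loss_difference[OF True]) (use supp in \<open>auto simp: d\<close>)
      hence "G \<theta> * (loss c \<theta> d' - loss c \<theta> d) = G \<theta> * \<dots>" by simp
      thus ?thesis by (simp add: algebra_simps sum_distrib_left)
    qed (simp add: G_def tilted_lik_outside)
  qed
  finally have "(\<integral>\<theta>. G \<theta> * loss c \<theta> d' - G \<theta> * loss c \<theta> d \<partial>?\<mu>) = ?D"
    by (rule has_bochner_integral_integral_eq)
  hence diff: "(\<integral>\<theta>. G \<theta> * loss c \<theta> d' \<partial>?\<mu>) = (\<integral>\<theta>. G \<theta> * loss c \<theta> d \<partial>?\<mu>) + ?D"
    using int int' by simp

  have D: "?D = m * Q + 2 * a * \<sigma> * m - 2 * (1 + c) * \<sigma> * C + c * (\<sigma>\<^sup>2 + 2 * \<sigma> * (a * ZZ)) * (m / (ZZ + P))"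
  proof -
    have "(\<Sum>i | 0 < y i. ((d' i - d i)\<^sup>2 + 2 * (d' i - d i) * d i) * (m / real (y i))) =
      (\<Sum>i | 0 < y i. m * ((d' i - d i)\<^sup>2 / real (y i)) + 2 * a * m * (d' i - d i))"
      by (rule sum.cong) (auto simp: d field_simps)
    also have "\<dots> = m * Q + 2 * a * m * (\<Sum>i | 0 < y i. d' i - d i)"
      by (simp add: sum.distrib sum_distrib_left Q_def)
    also have "(\<Sum>i | 0 < y i. d' i - d i) = \<sigma>"
      unfolding \<sigma>_def by (rule sum.mono_neutral_left) (use supp in \<open>auto simp: d\<close>)
    finally show ?thesis unfolding s by simp
  qed
  have "m * Q / 2 \<le> ?D + 8 * (1 + c)\<^sup>2 / (real n)\<^sup>2 * (T / (ZZ + P))"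
    unfolding D a_def
  proof (rule quadratic_comparison[OF Z0 P _ c m0])
    show "0 < real n" using n by simp
    obtain k where k: "total y = Suc k" using Z by (cases "total y") auto
    have ZP2: "real (k + ?q + 2) = ZZ + P" using p by (simp add: ZZ_def P_def k)
    show "ZZ * m - (ZZ + P) * C = 2 / real n * taper_moment ?q n 1 (total y)"
      using taper_moment_recursion[OF n, of k ?q] unfolding ZP2 m_def C_def by (simp add: k ZZ_def)
    show "0 \<le> a\<^sup>2 * m + 2 * a * b * taper_moment ?q n 1 (total y) + b\<^sup>2 * T" for a b
      using taper_moment_square_nonneg[OF n, of a ?q k b] by (simp add: m_def T_def k)
    have "(\<Sum>i | 0 < y i. d' i - d i)\<^sup>2 \<le> Q * (\<Sum>i | 0 < y i. real (y i))"
      unfolding Q_def by (rule square_sum_div_le) auto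
    moreover have "(\<Sum>i | 0 < y i. d' i - d i) = \<sigma>"
      unfolding \<sigma>_def by (rule sum.mono_neutral_left) (use supp in \<open>auto simp: d\<close>)
    moreover have "(\<Sum>i | 0 < y i. real (y i)) = ZZ"
      unfolding ZZ_def total_def of_nat_sum by (rule sum.mono_neutral_left) auto
    ultimately show "\<sigma>\<^sup>2 \<le> Q * ZZ" by simp
  qed
  hence "(\<integral>\<theta>. G \<theta> * loss c \<theta> d \<partial>?\<mu>) + m * Q / 2 \<le>
      (\<integral>\<theta>. G \<theta> * loss c \<theta> d' \<partial>?\<mu>) + 8 * (1 + c)\<^sup>2 / (real n)\<^sup>2 * (T / (ZZ + P))"
    unfolding diff by linarith
  moreover have "0 \<le> m * Q / 2" using m0 by (auto simp: Q_def intro!: mult_nonneg_nonneg sum_nonneg)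
  moreover have "0 \<le> 8 * (1 + c)\<^sup>2 / (real n)\<^sup>2 * (T / (ZZ + P))" using m0 Z0 P by simp
  moreover have "0 \<le> (\<integral>\<theta>. G \<theta> * loss c \<theta> e \<partial>?\<mu>)" for e
    by (rule integral_nonneg_AE) (rule nn)
  ultimately have "ennreal (\<integral>\<theta>. G \<theta> * loss c \<theta> d \<partial>?\<mu>) + ennreal (m * Q / 2) \<le>
      ennreal (\<integral>\<theta>. G \<theta> * loss c \<theta> d' \<partial>?\<mu>) + ennreal (8 * (1 + c)\<^sup>2 / (real n)\<^sup>2 * (T / (ZZ + P)))"
    by (simp flip: ennreal_plus)
  also have "ennreal (\<integral>\<theta>. G \<theta> * loss c \<theta> d \<partial>?\<mu>) = (\<integral>\<^sup>+\<theta>. ennreal (G \<theta> * loss c \<theta> d) \<partial>?\<mu>)"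
    by (rule nn_integral_eq_integral[symmetric, OF int nn])
  also have "ennreal (\<integral>\<theta>. G \<theta> * loss c \<theta> d' \<partial>?\<mu>) = (\<integral>\<^sup>+\<theta>. ennreal (G \<theta> * loss c \<theta> d') \<partial>?\<mu>)"
    by (rule nn_integral_eq_integral[symmetric, OF int' nn])
  finally show ?thesis unfolding G_def d_def m_def Q_def T_def ZP[symmetric] .
qed


section \<open>Admissibility\<close>
lemma integrated_risk:
  fixes \<delta> :: "'n::finite estimator"
  shows "(\<integral>\<^sup>+\<theta>. indicator param_space \<theta> * risk (loss c) \<delta> \<theta> \<partial>prior n) =
    (\<integral>\<^sup>+y. (\<integral>\<^sup>+\<theta>. ennreal (tilted_lik y 1 \<theta> * loss c \<theta> (\<delta> y)) \<partial>prior n) \<partial>count_space UNIV)"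
proof -
  have "(\<integral>\<^sup>+\<theta>. indicator param_space \<theta> * risk (loss c) \<delta> \<theta> \<partial>prior n) =
     (\<integral>\<^sup>+\<theta>. (\<integral>\<^sup>+y. ennreal (tilted_lik y 1 \<theta> * loss c \<theta> (\<delta> y)) \<partial>count_space UNIV) \<partial>prior n)"
  proof (rule nn_integral_cong)
    fix \<theta> :: "'n \<Rightarrow> real"
    show "indicator param_space \<theta> * risk (loss c) \<delta> \<theta> =
      (\<integral>\<^sup>+y. ennreal (tilted_lik y 1 \<theta> * loss c \<theta> (\<delta> y)) \<partial>count_space UNIV)"
      by (cases "\<theta> \<in> param_space") (simp_all add: risk_as_count_integral tilted_lik_outside)
  qed
  also have "\<dots> = (\<integral>\<^sup>+y. (\<integral>\<^sup>+\<theta>. ennreal (tilted_lik y 1 \<theta> * loss c \<theta> (\<delta> y)) \<partial>prior n) \<partial>count_space UNIV)"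
    by (rule nn_integral_count_space_nn_integral) auto
  finally show ?thesis .
qed

text \<open>
  Summing the posterior comparison over all observations, but retaining the squared distance only at
  y0. Domination makes the integrated risks cancel, which is legitimate because they are finite, and
  what is left on the right is the sum of the possible gains.
\<close>
lemma dominating_estimator_gap:
  fixes \<delta>' :: "'n::finite estimator"
  assumes c: "0 \<le> c" and p: "2 \<le> CARD('n)" and n: "0 < n" and y0: "0 < total y0"
    and dom: "\<And>\<theta>. \<theta> \<in> param_space \<Longrightarrow> risk (loss c) \<delta>' \<theta> \<le> risk (loss c) (delta_c c) \<theta>"
    and supp: "\<And>y i. y i = 0 \<Longrightarrow> \<delta>' y i = 0"
  shows "taper_moment (CARD('n) - 2) n 2 (total y0 - 1) *
      (\<Sum>i | 0 < y0 i. (\<delta>' y0 i - delta_c c y0 i)\<^sup>2 / real (y0 i)) / 2 \<le> 8 * (1 + c)\<^sup>2 / real n"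
proof -
  let ?C = "count_space (UNIV :: ('n \<Rightarrow> nat) set)"
  let ?q = "CARD('n) - 2"
  let ?I = "\<lambda>(\<delta> :: 'n estimator) y. \<integral>\<^sup>+\<theta>. ennreal (tilted_lik y 1 \<theta> * loss c \<theta> (\<delta> y)) \<partial>prior n"
  define g where "g = taper_moment ?q n 2 (total y0 - 1) *
      (\<Sum>i | 0 < y0 i. (\<delta>' y0 i - delta_c c y0 i)\<^sup>2 / real (y0 i)) / 2"
  define k where "k = 8 * (1 + c)\<^sup>2 / (real n)\<^sup>2"
  define K where "K = (\<lambda>y :: 'n \<Rightarrow> nat. taper_moment ?q n 0 (total y + 1) / real (total y + CARD('n) - 1))"
  have k0: "0 \<le> k" by (simp add: k_def)
  have K0: "0 \<le> K y" for y unfolding K_def using taper_moment_nonneg[OF n] by simp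

  have le: "(\<integral>\<^sup>+y. ?I \<delta>' y \<partial>?C) \<le> (\<integral>\<^sup>+y. ?I (delta_c c) y \<partial>?C)"
    unfolding integrated_risk[symmetric]
    by (rule nn_integral_mono) (auto split: split_indicator intro: dom)
  have fin: "(\<integral>\<^sup>+y. ?I (delta_c c) y \<partial>?C) < \<infinity>"
  proof -
    let ?B = "ennreal (2 * (1 + c) * (real CARD('n))\<^sup>2)"
    have "(\<integral>\<^sup>+y. ?I (delta_c c) y \<partial>?C) \<le> (\<integral>\<^sup>+\<theta>. ?B \<partial>(prior n :: ('n \<Rightarrow> real) measure))"
      unfolding integrated_risk[symmetric]
    proof (rule nn_integral_mono)
      fix \<theta> :: "'n \<Rightarrow> real"
      show "indicator param_space \<theta> * risk (loss c) (delta_c c) \<theta> \<le> ?B"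
        using risk_delta_c_bounded[OF c p, of \<theta>] by (cases "\<theta> \<in> param_space") simp_all
    qed
    also have "\<dots> = ?B * emeasure (prior n :: ('n \<Rightarrow> real) measure) UNIV" by simp
    also have "\<dots> < \<infinity>" using emeasure_prior_finite[OF n p] by (simp add: ennreal_mult_less_top)
    finally show ?thesis .
  qed
  have point: "?I \<delta> y < \<infinity>" if "(\<integral>\<^sup>+y. ?I \<delta> y \<partial>?C) < \<infinity>" for \<delta> and y :: "'n \<Rightarrow> nat"
    using nn_integral_ge_point[of y UNIV "?I \<delta>"] that by (simp add: order.strict_trans1)

  define A where "A = ?I (delta_c c)"
  define A' where "A' = ?I \<delta>'"
  have step: "A y + ennreal g * indicator {y0} y \<le> A' y + ennreal k * ennreal (K y)" for y
  proof (cases "0 < total y")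
    case True
    define h where "h = taper_moment ?q n 2 (total y - 1) *
        (\<Sum>i | 0 < y i. (\<delta>' y i - delta_c c y i)\<^sup>2 / real (y i)) / 2"
    have "ennreal g * indicator {y0} y \<le> ennreal h"
      by (cases "y = y0") (simp_all add: g_def h_def)
    hence "A y + ennreal g * indicator {y0} y \<le> A y + ennreal h"
      by (rule add_left_mono)
    also have "\<dots> \<le> A' y + ennreal (k * K y)"
      unfolding A_def A'_def h_def k_def K_def
      by (rule posterior_loss_comparison[OF c p n True])
        (use point[OF fin] point[OF order.strict_trans1[OF le fin]] supp in auto)
    also have "ennreal (k * K y) = ennreal k * ennreal (K y)" by (rule ennreal_mult'[OF k0])
    finally show ?thesis .
  next
    case False
    hence y: "y i = 0" for i using component_le_total[of y i] by simp
    have "delta_c c y = \<delta>' y" by (rule ext) (simp add: y supp delta_c_def)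
    hence "A y = A' y" by (simp add: A_def A'_def)
    moreover have "y \<noteq> y0" using False y0 by auto
    ultimately show ?thesis by simp
  qed
  have "(\<integral>\<^sup>+y. A y \<partial>?C) + ennreal g = (\<integral>\<^sup>+y. A y + ennreal g * indicator {y0} y \<partial>?C)"
    by (simp add: nn_integral_add nn_integral_cmult)
  also have "\<dots> \<le> (\<integral>\<^sup>+y. A' y + ennreal k * ennreal (K y) \<partial>?C)"
    by (rule nn_integral_mono) (rule step)
  also have "\<dots> = (\<integral>\<^sup>+y. A' y \<partial>?C) + ennreal k * (\<integral>\<^sup>+y. ennreal (K y) \<partial>?C)"
    by (simp add: nn_integral_add nn_integral_cmult)
  also have "\<dots> \<le> (\<integral>\<^sup>+y. A y \<partial>?C) + ennreal k * ennreal (real n)"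
  proof (rule add_mono)
    show "(\<integral>\<^sup>+y. A' y \<partial>?C) \<le> (\<integral>\<^sup>+y. A y \<partial>?C)" using le by (simp only: A_def A'_def)
    show "ennreal k * (\<integral>\<^sup>+y. ennreal (K y) \<partial>?C) \<le> ennreal k * ennreal (real n)"
      unfolding K_def by (rule mult_left_mono[OF count_sum_taper_moment[OF n p]]) simp
  qed
  finally have "(\<integral>\<^sup>+y. A y \<partial>?C) + ennreal g \<le> (\<integral>\<^sup>+y. A y \<partial>?C) + ennreal k * ennreal (real n)" .
  moreover have "(\<integral>\<^sup>+y. A y \<partial>?C) \<noteq> \<infinity>" using fin by (simp add: A_def)
  ultimately have "ennreal g \<le> ennreal k * ennreal (real n)"
    using ennreal_add_left_cancel_le by blast
  also have "\<dots> = ennreal (8 * (1 + c)\<^sup>2 / real n)"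
    using k0 n by (simp add: k_def power2_eq_square flip: ennreal_mult')
  finally show ?thesis by (simp add: g_def ennreal_le_iff)
qed

lemma admissible_delta_c:
  fixes c :: real
  assumes c: "0 \<le> c" and p: "2 \<le> CARD('n::finite)"
  shows "admissible (loss c) (delta_c c :: 'n estimator)"
proof (rule ccontr)
  assume "\<not> admissible (loss c) (delta_c c :: 'n estimator)"
  then obtain \<delta>' :: "'n estimator" and \<theta>0 where
    dom: "\<And>\<theta>. \<theta> \<in> param_space \<Longrightarrow> risk (loss c) \<delta>' \<theta> \<le> risk (loss c) (delta_c c) \<theta>" and
    \<theta>0: "risk (loss c) \<delta>' \<theta>0 < risk (loss c) (delta_c c) \<theta>0"
    unfolding admissible_def by blast
  have supp: "\<delta>' y i = 0" if "y i = 0" for y i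
    by (rule bounded_risk_imp_zero[OF c, of "2 * (1 + c) * (real CARD('n))\<^sup>2"])
      (use c that order_trans[OF dom risk_delta_c_bounded[OF c p]] in auto)
  have "\<delta>' \<noteq> delta_c c" using \<theta>0 by auto
  then obtain y0 i0 where neq: "\<delta>' y0 i0 \<noteq> delta_c c y0 i0" by (meson ext)
  hence i0: "0 < y0 i0" using supp[of y0 i0] by (cases "y0 i0") (auto simp: delta_c_def)
  hence tot: "0 < total y0" using component_le_total[of y0 i0] by simp
  define Q where "Q = (\<Sum>i | 0 < y0 i. (\<delta>' y0 i - delta_c c y0 i)\<^sup>2 / real (y0 i))"
  have "0 < Q" unfolding Q_def using neq i0
    by (intro sum_pos2[where i = i0]) auto
  obtain r where r: "0 < r" "\<And>n. 0 < n \<Longrightarrow> r \<le> taper_moment (CARD('n) - 2) n 2 (total y0 - 1)"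
    using taper_moment_lower_bound by blast
  have bound: "r * Q / 2 \<le> 8 * (1 + c)\<^sup>2 / real n" if "0 < n" for n
  proof -
    have "r * Q / 2 \<le> taper_moment (CARD('n) - 2) n 2 (total y0 - 1) * Q / 2"
      using r(2)[OF that] \<open>0 < Q\<close> by simp
    also have "\<dots> \<le> 8 * (1 + c)\<^sup>2 / real n"
      unfolding Q_def by (rule dominating_estimator_gap[OF c p that tot dom supp])
    finally show ?thesis .
  qed
  have rQ: "0 < r * Q / 2" using r \<open>0 < Q\<close> by simp
  obtain n :: nat where nn: "8 * (1 + c)\<^sup>2 / (r * Q / 2) < real n" using reals_Archimedean2 by blast
  moreover have "0 \<le> 8 * (1 + c)\<^sup>2 / (r * Q / 2)" using rQ by simp
  ultimately have "0 < real n" by linarith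
  hence "8 * (1 + c)\<^sup>2 / real n < r * Q / 2"
    using nn rQ by (simp add: field_simps)
  with bound[of n] \<open>0 < real n\<close> show False by simp
qed

theorem mainTheorem4:
  fixes c :: real
  assumes "c \<ge> 0" and "CARD('n::finite) \<ge> 2"
  shows "admissible (loss c) (delta_c c :: 'n estimator) \<and>
         admissible std_loss (clevenson_zidek :: 'n estimator)"
proof -
  have "loss 0 = (std_loss :: ('n \<Rightarrow> real) \<Rightarrow> ('n \<Rightarrow> real) \<Rightarrow> real)"
    by (intro ext) (simp add: loss_def std_loss_def)
  moreover have "delta_c 0 = (clevenson_zidek :: 'n estimator)"
    by (intro ext) (simp add: delta_c_def clevenson_zidek_def)
  ultimately show ?thesis
    using admissible_delta_c[OF assms] admissible_delta_c[of 0, OF _ assms(2)] by simp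
qed

end
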